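(* Let $\mu\ge 0$ be fixed. Suppose that the real-valued functions $u_1(t)$, $u_2(t)$ and $\Lambda(t)$ are solutions of the differential system $$\begin{aligned} \frac{\mathrm{d}u_1}{\mathrm{d}t}&=2u_1(t),\\ \frac{\mathrm{d}u_2}{\mathrm{d}t}&=2(\Lambda(t)+1)(u_1(t)+u_2(t)^2)-(2\mu+1)u_2(t),\\ \frac{\mathrm{d}\Lambda}{\mathrm{d}t}&=(1+2\mu-2\Lambda(t)u_2(t))(\Lambda(t)+2)-2\mu \end{aligned}$$ on an interval $I\subset\mathbb{R}$ with $0\in I$, satisfying $u_1(0)=a$, $u_2(0)=b$, $\Lambda(0)=\Lambda_0$ with some given initial values $a,b\in\mathbb{R}$ and $\Lambda_0$ such that $$\Theta\big(\Lambda_0,\,a,\,b,\,(a+b^2-1)\Lambda_0-2(\mu+1)b\big)=0,$$ where $\Theta$ is the connection coefficient defined in the context. If $\Lambda(t_0)=0$ holds for some $t_0\in I$, then $\lambda=(\mu+1)(\mu-2u_2(t_0))$ is an eigenvalue of the angular spheroidal wave equation $$\frac{\mathrm{d}}{\mathrm{d}x}\left((1-x^2)\frac{\mathrm{d}}{\mathrm{d}x}w(x)\right)+\left(\lambda+\gamma^2(1-x^2)-\frac{\mu^2}{1-x^2}\right)w(x)=0,\quad -1<x<1,$$ for the parameter $\gamma^2=u_1(t_0)$.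
   Context: Fix a real number $\mu\ge 0$ and set $\alpha:=\frac12(\mu+1)$. The parameter $\gamma^2$ is real (possibly negative). A number $\lambda\in\mathbb{C}$ is called an eigenvalue of the angular spheroidal wave equation (for given $\gamma^2,\mu$) if the equation has a nontrivial bounded solution $w$ on $(-1,1)$. Definition of $\Theta(\Lambda,\mathbf{u})=\Theta(\Lambda,u_1,u_2,u_3)$ for $(\Lambda,\mathbf{u})\in\mathbb{C}\times\mathbb{R}^3$: consider on $0<z<1$ the $2\times2$ system $$y'(z)=\left(\frac1z\begin{pmatrix}-\alpha&u_3+\Lambda\\0&\alpha\end{pmatrix}+\frac{1}{1-z}\begin{pmatrix}\alpha&0\\-\Lambda&-\alpha\end{pmatrix}+\begin{pmatrix}2u_2&2(u_1+u_2^2)\\-2&-2u_2\end{pmatrix}\right)y(z).$$ With $A:=\mathrm{diag}(-\alpha,\alpha)$, it has fundamental matrices of the form $$Y_0(z)=F_0(z)\,z^A z^{Q_0},\qquad Y_1(z)=F_1(z)\,(1-z)^A(1-z)^{Q_1},$$ where $F_0$ is a holomorphic matrix function on $\{|z|<1\}$ and $F_1$ is a holomorphic matrix function on $\{|z-1|<1\}$ (both depending analytically on $(\Lambda,\mathbf{u})$), with $$F_0(0)=\begin{pmatrix}1&\frac{u_3+\Lambda}{2\alpha}\\0&1\end{pmatrix},\quad F_1(1)=\begin{pmatrix}1&0\\-\frac{\Lambda}{2\alpha}&1\end{pmatrix},\quad Q_j=\begin{pmatrix} 0 & 0 \\ {q_j} & 0 \end{pmatrix}\ (j=0,1),$$ and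 $q_j=q_j(\Lambda,\mathbf{u})\in\mathbb{C}$ analytic, with $q_j\equiv0$ if $\mu+1$ is not an integer. With $e_1,e_2$ the standard basis of $\mathbb{C}^2$, put $\eta_0:=Y_0e_2$, $y_1:=Y_1e_1$, $\eta_1:=Y_1e_2$. The connection coefficients $\Theta,\Omega$ are the unique numbers with $$\eta_0(z,\Lambda,\mathbf{u})=\Theta(\Lambda,\mathbf{u})\,y_1(z,\Lambda,\mathbf{u})+\Omega(\Lambda,\mathbf{u})\,\eta_1(z,\Lambda,\mathbf{u}),\quad 0<z<1.$$ *)

theory Defs
  imports "HOL-Analysis.Analysis"
begin

definition mat22 :: "complex \<Rightarrow> complex \<Rightarrow> complex \<Rightarrow> complex \<Rightarrow> complex^2^2" where
  "mat22 a b c d = vector [vector [a, b], vector [c, d]]"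

definition alpha :: "real \<Rightarrow> real" where
  "alpha \<mu> = (\<mu> + 1) / 2"

definition system_matrix ::
    "real \<Rightarrow> complex \<Rightarrow> real \<Rightarrow> real \<Rightarrow> real \<Rightarrow> real \<Rightarrow> complex^2^2" where
  "system_matrix \<mu> \<Lambda> u1 u2 u3 z =
     (1 / z) *\<^sub>R mat22 (- of_real (alpha \<mu>)) (of_real u3 + \<Lambda>) 0 (of_real (alpha \<mu>))
   + (1 / (1 - z)) *\<^sub>R mat22 (of_real (alpha \<mu>)) 0 (- \<Lambda>) (- of_real (alpha \<mu>))
   + mat22 (of_real (2 * u2)) (of_real (2 * (u1 + u2^2))) (- 2) (of_real (- 2 * u2))"

definition fundamental_matrix :: "(real \<Rightarrow> complex^2^2) \<Rightarrow> (real \<Rightarrow> complex^2^2) \<Rightarrow> bool" where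
  "fundamental_matrix M Y \<longleftrightarrow>
     (\<forall>z\<in>{0<..<1}. (Y has_vector_derivative M z ** Y z) (at z) \<and> invertible (Y z))"

text \<open>The matrix powers \<open>s\<^sup>A = exp (ln s * A)\<close>, \<open>A = diag (-\<alpha>, \<alpha>)\<close>, and
  \<open>s\<^sup>Q = exp (ln s * Q)\<close>, for \<open>s > 0\<close>. Here \<open>Q\<close> is the strictly lower triangular matrix
  with entry \<open>q\<close>, so \<open>Q ** Q = 0\<close> and the exponential series stops after its linear term.\<close>

definition powA :: "real \<Rightarrow> real \<Rightarrow> complex^2^2" where
  "powA \<mu> s = mat22 (of_real (s powr (- alpha \<mu>))) 0 0 (of_real (s powr alpha \<mu>))"

definition powQ :: "complex \<Rightarrow> real \<Rightarrow> complex^2^2" where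
  "powQ q s = mat 1 + ln s *\<^sub>R mat22 0 0 q 0"

definition holomorphic_matrix_on :: "(complex \<Rightarrow> complex^2^2) \<Rightarrow> complex set \<Rightarrow> bool" where
  "holomorphic_matrix_on F S \<longleftrightarrow> (\<forall>i j. (\<lambda>z. F z $ i $ j) holomorphic_on S)"

definition Y0 :: "real \<Rightarrow> (complex \<Rightarrow> complex^2^2) \<Rightarrow> complex \<Rightarrow> real \<Rightarrow> complex^2^2" where
  "Y0 \<mu> F q z = F (of_real z) ** powA \<mu> z ** powQ q z"

definition Y1 :: "real \<Rightarrow> (complex \<Rightarrow> complex^2^2) \<Rightarrow> complex \<Rightarrow> real \<Rightarrow> complex^2^2" where
  "Y1 \<mu> F q z = F (of_real z) ** powA \<mu> (1 - z) ** powQ q (1 - z)"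

definition local_data_0 ::
    "real \<Rightarrow> complex \<Rightarrow> real \<Rightarrow> real \<Rightarrow> real \<Rightarrow> (complex \<Rightarrow> complex^2^2) \<Rightarrow> complex \<Rightarrow> bool" where
  "local_data_0 \<mu> \<Lambda> u1 u2 u3 F q \<longleftrightarrow>
     holomorphic_matrix_on F (ball 0 1) \<and>
     F 0 = mat22 1 ((of_real u3 + \<Lambda>) / of_real (2 * alpha \<mu>)) 0 1 \<and>
     (\<mu> + 1 \<notin> \<int> \<longrightarrow> q = 0) \<and>
     fundamental_matrix (system_matrix \<mu> \<Lambda> u1 u2 u3) (Y0 \<mu> F q)"

definition local_data_1 ::
    "real \<Rightarrow> complex \<Rightarrow> real \<Rightarrow> real \<Rightarrow> real \<Rightarrow> (complex \<Rightarrow> complex^2^2) \<Rightarrow> complex \<Rightarrow> bool" where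
  "local_data_1 \<mu> \<Lambda> u1 u2 u3 F q \<longleftrightarrow>
     holomorphic_matrix_on F (ball 1 1) \<and>
     F 1 = mat22 1 0 (- \<Lambda> / of_real (2 * alpha \<mu>)) 1 \<and>
     (\<mu> + 1 \<notin> \<int> \<longrightarrow> q = 0) \<and>
     fundamental_matrix (system_matrix \<mu> \<Lambda> u1 u2 u3) (Y1 \<mu> F q)"

definition connection_coefficients ::
    "real \<Rightarrow> complex \<Rightarrow> real \<Rightarrow> real \<Rightarrow> real \<Rightarrow> complex \<Rightarrow> complex \<Rightarrow> bool" where
  "connection_coefficients \<mu> \<Lambda> u1 u2 u3 \<theta> \<omega> \<longleftrightarrow>
     (\<exists>F0 q0 F1 q1.
        local_data_0 \<mu> \<Lambda> u1 u2 u3 F0 q0 \<and> local_data_1 \<mu> \<Lambda> u1 u2 u3 F1 q1 \<and>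
        (\<forall>z\<in>{0<..<1}. Y0 \<mu> F0 q0 z *v axis 2 1 =
           \<theta> *s (Y1 \<mu> F1 q1 z *v axis 1 1) + \<omega> *s (Y1 \<mu> F1 q1 z *v axis 2 1)))"

text \<open>If \<open>\<mu> + 1\<close> is an integer, the local data are not unique: the first column of \<open>Y0\<close> may be
  changed by a multiple of its second column, and likewise for \<open>Y1\<close>. The second columns are
  unique, so such a change affects only the coefficient \<open>\<omega>\<close> of the second column of \<open>Y1\<close>,
  never the coefficient \<open>\<theta>\<close> of the first one. For the same reason it does not matter that the
  data are taken separately at each \<open>(\<Lambda>, u1, u2, u3)\<close>, and not as families depending
  analytically on these parameters.\<close>

definition Theta :: "real \<Rightarrow> complex \<Rightarrow> real \<Rightarrow> real \<Rightarrow> real \<Rightarrow> complex" where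
  "Theta \<mu> \<Lambda> u1 u2 u3 = (THE \<theta>. \<exists>\<omega>. connection_coefficients \<mu> \<Lambda> u1 u2 u3 \<theta> \<omega>)"

text \<open>The real number \<open>g\<close> is the parameter written \<open>\<gamma>\<^sup>2\<close> (possibly negative);
  \<open>w'\<close> is the derivative of \<open>w\<close>.\<close>

definition spheroidal_solution ::
    "real \<Rightarrow> real \<Rightarrow> complex \<Rightarrow> (real \<Rightarrow> complex) \<Rightarrow> bool" where
  "spheroidal_solution \<mu> g ev w \<longleftrightarrow>
     (\<exists>w'. \<forall>x\<in>{-1<..<1}.
        (w has_vector_derivative w' x) (at x) \<and>
        ((\<lambda>x. of_real (1 - x^2) * w' x) has_vector_derivative
           - ((ev + of_real (g * (1 - x^2)) - of_real (\<mu>^2 / (1 - x^2))) * w x)) (at x))"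

definition spheroidal_eigenvalue :: "real \<Rightarrow> real \<Rightarrow> complex \<Rightarrow> bool" where
  "spheroidal_eigenvalue \<mu> g ev \<longleftrightarrow>
     (\<exists>w. spheroidal_solution \<mu> g ev w \<and> bounded (w ` {-1<..<1}) \<and> (\<exists>x\<in>{-1<..<1}. w x \<noteq> 0))"

end

theory Submission
  imports Defs
begin

text \<open>
  The system for \<open>y\<close> has regular singular points at \<open>z = 0\<close> and \<open>z = 1\<close>, each with exponents
  \<open>-\<alpha>\<close> and \<open>\<alpha>\<close>. The second column of \<open>Y\<^sub>0\<close> (of \<open>Y\<^sub>1\<close>) is the recessive solution at \<open>0\<close> (at
  \<open>1\<close>), and \<open>\<Theta> = 0\<close> says that the two are proportional: the system then has a nontrivial
  solution that is \<open>O ((z (1 - z)) powr \<alpha>)\<close> on the whole interval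
  (\<open>Theta_zero_imp_decaying_solution\<close>).

  The differential equations for \<open>u\<^sub>1\<close>, \<open>u\<^sub>2\<close>, \<open>\<Lambda>\<close> are an isomonodromic deformation. If \<open>M\<close> is the
  coefficient matrix, with \<open>u\<^sub>3 = (u\<^sub>1 + u\<^sub>2\<^sup>2 - 1) \<Lambda> - 2 (\<mu> + 1) u\<^sub>2\<close>, and \<open>N = B + z C\<close>, where \<open>C\<close> is
  the value of \<open>M\<close> at \<open>z = \<infinity>\<close> and \<open>B\<close> is a suitable upper triangular matrix that does not depend
  on \<open>z\<close>, then the zero curvature equation \<open>\<partial>\<^sub>t M - \<partial>\<^sub>z N + M N - N M = 0\<close> holds (\<open>zero_curvature\<close>).
  Hence transporting a solution of the \<open>z\<close>-equation along \<open>\<partial>\<^sub>t y = N y\<close> gives a solution of the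
  \<open>z\<close>-equation for the new parameters. Moreover \<open>N\<close> is bounded on
  \<open>0 < z < 1\<close>, even near the singular points of \<open>M\<close>: by Gronwall's inequality the transport
  changes the norm of a solution at most by a factor that does not depend on \<open>z\<close>, so it preserves
  both the decay at the end points and the nonvanishing (\<open>isomonodromic_transport\<close>). The proof
  thus follows the decaying solution along the deformation, instead of \<open>\<Theta>\<close>.

  At a time with \<open>\<Lambda> = 0\<close> the second component of the system, divided by the square root of
  \<open>z (1 - z)\<close>, satisfies the spheroidal equation in \<open>x = 2 z - 1\<close>, with \<open>\<gamma>\<^sup>2 = u\<^sub>1\<close> and
  \<open>\<lambda> = (\<mu> + 1) (\<mu> - 2 u\<^sub>2)\<close>. Since \<open>\<alpha> - 1/2 = \<mu>/2 \<ge> 0\<close>, decay of order \<open>\<alpha>\<close> makes it bounded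
  (\<open>spheroidal_eigenvalue_of_solution\<close>).

  As \<open>\<Theta>\<close> is a definite description, the hypothesis \<open>\<Theta> = 0\<close> has content only once existence and
  uniqueness of the connection coefficient are known. Existence needs the fundamental matrices
  \<open>Y\<^sub>0\<close> and \<open>Y\<^sub>1\<close>, which Frobenius series provide, with a logarithm if \<open>2 \<alpha>\<close> is an integer
  (\<open>frobenius_solution_exists\<close>). Uniqueness rests on Wronskians: the coefficient matrix is
  traceless, so the determinant of two solutions is constant. This shows that the recessive
  solutions are unique (\<open>recessive_solution_unique\<close>) and that \<open>\<Theta>\<close> is their Wronskian
  (\<open>connection_coefficient_unique\<close>).
\<close>

section \<open>Linear differential equations on the unit interval\<close>

text \<open>Picard iteration. Consecutive iterates differ by at most \<open>D (L t)\<^sup>n / n!\<close>, so they converge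
  uniformly on the whole interval, however large the Lipschitz constant is.\<close>
lemma lipschitz_ode_solution_exists:
  fixes F :: "real \<Rightarrow> 'a::banach \<Rightarrow> 'a" and K :: real
  assumes cont: "\<And>y. continuous_on {0..1} y \<Longrightarrow> continuous_on {0..1} (\<lambda>s. F s (y s))"
    and lip: "\<And>s x y. s \<in> {0..1} \<Longrightarrow> norm (F s x - F s y) \<le> K * norm (x - y)"
  obtains y where "y 0 = y0"
    "\<And>s. s \<in> {0..1} \<Longrightarrow> (y has_vector_derivative F s (y s)) (at s within {0..1})"
proof -
  define Y where "Y = rec_nat (\<lambda>_. y0) (\<lambda>_ f t. y0 + integral {0..t} (\<lambda>s. F s (f s)))"
  have Y_0: "Y 0 = (\<lambda>_. y0)"
    and Y_Suc: "\<And>n. Y (Suc n) = (\<lambda>t. y0 + integral {0..t} (\<lambda>s. F s (Y n s)))"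
    by (simp_all add: Y_def)
  have integral_cont: "continuous_on {0..1} (\<lambda>t. integral {0..t} (\<lambda>s. F s (f s)))"
    if "continuous_on {0..1} f" for f
    by (intro indefinite_integral_continuous_1 integrable_continuous_real cont that)
  have Y_cont: "continuous_on {0..1} (Y n)" for n
    by (induction n) (auto simp: Y_0 Y_Suc intro!: continuous_intros integral_cont)
  have integrable: "(\<lambda>s. F s (f s)) integrable_on {0..t}"
    if "continuous_on {0..1} f" "t \<le> 1" for f t
    by (rule integrable_continuous_real, rule continuous_on_subset[OF cont[OF that(1)]]) (use that in auto)
  \<comment> \<open>A negative Lipschitz constant can occur only if the type is trivial; replacing it by \<open>0\<close> avoids that case.\<close>
  define L where "L = max K 0"
  have L: "L \<ge> 0" by (simp add: L_def)
  have lipL: "norm (F s x - F s y) \<le> L * norm (x - y)" if "s \<in> {0..1}" for s x y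
    by (rule order_trans[OF lip[OF that]]) (simp add: L_def mult_right_mono)
  obtain D where D: "\<And>t. t \<in> {0..1} \<Longrightarrow> norm (Y 1 t - Y 0 t) \<le> D" 
  proof -
    have "bounded ((\<lambda>t. Y 1 t - Y 0 t) ` {0..1})"
      by (intro compact_imp_bounded compact_continuous_image continuous_intros Y_cont) auto
    then obtain D where "\<forall>t\<in>{0..1}. norm (Y 1 t - Y 0 t) \<le> D" unfolding bounded_iff by auto
    thus ?thesis by (intro that) blast
  qed
  have D0: "D \<ge> 0" by (rule order_trans[OF norm_ge_zero D[of 0]]) simp
  have step: "norm (Y (Suc n) t - Y n t) \<le> D * L ^ n * t ^ n / fact n" if "t \<in> {0..1}" for n t
    using that
  proof (induction n arbitrary: t)
    case 0
    then show ?case using D by simp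
  next
    case (Suc n)
    have "Y (Suc (Suc n)) t - Y (Suc n) t = integral {0..t} (\<lambda>s. F s (Y (Suc n) s) - F s (Y n s))"
      using Suc.prems by (subst Henstock_Kurzweil_Integration.integral_diff[OF
            integrable[OF Y_cont] integrable[OF Y_cont]]) (simp_all add: Y_Suc)
    also have "norm \<dots> \<le> integral {0..t} (\<lambda>s. D * L ^ Suc n * s ^ n / fact n)"
    proof (rule integral_norm_bound_integral)
      show "(\<lambda>s. F s (Y (Suc n) s) - F s (Y n s)) integrable_on {0..t}"
        using Suc.prems by (intro Henstock_Kurzweil_Integration.integrable_diff integrable Y_cont) auto
      show "(\<lambda>s. D * L ^ Suc n * s ^ n / fact n) integrable_on {0..t}"
        by (intro integrable_continuous_real continuous_intros) simp
      fix s assume s: "s \<in> {0..t}"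
      have "norm (F s (Y (Suc n) s) - F s (Y n s)) \<le> L * norm (Y (Suc n) s - Y n s)"
        using s Suc.prems by (intro lipL) auto
      also have "\<dots> \<le> L * (D * L ^ n * s ^ n / fact n)"
        using s Suc.prems L by (intro mult_left_mono Suc.IH) auto
      finally show "norm (F s (Y (Suc n) s) - F s (Y n s)) \<le> D * L ^ Suc n * s ^ n / fact n"
        by (simp add: mult_ac)
    qed
    also have "integral {0..t} (\<lambda>s. D * L ^ Suc n * s ^ n / fact n)
        = D * L ^ Suc n * t ^ Suc n / fact (Suc n)"
    proof -
      have "((\<lambda>s. D * L ^ Suc n * s ^ n / fact n) has_integral
          D * L ^ Suc n / fact (Suc n) * t ^ Suc n - D * L ^ Suc n / fact (Suc n) * 0 ^ Suc n) {0..t}"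
      proof (rule fundamental_theorem_of_calculus)
        fix s assume "s \<in> {0..t}"
        have "((\<lambda>s. D * L ^ Suc n / fact (Suc n) * s ^ Suc n) has_real_derivative
            D * L ^ Suc n / fact (Suc n) * (real (Suc n) * s ^ n)) (at s within {0..t})"
          by (intro DERIV_cmult) (use DERIV_pow[of "Suc n" s] in simp)
        thus "((\<lambda>s. D * L ^ Suc n / fact (Suc n) * s ^ Suc n) has_vector_derivative
            D * L ^ Suc n * s ^ n / fact n) (at s within {0..t})"
          by (simp add: has_real_derivative_iff_has_vector_derivative mult.assoc del: of_nat_Suc power_Suc)
      qed (use Suc.prems in auto)
      from integral_unique[OF this] show ?thesis by simp
    qed
    finally show ?case .
  qed
  have step': "norm (Y (Suc n) t - Y n t) \<le> D * (L ^ n / fact n)" if "t \<in> {0..1}" for n t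
  proof -
    have "D * L ^ n * t ^ n / fact n \<le> D * L ^ n * 1 / fact n"
      using that L D0 by (intro divide_right_mono mult_left_mono power_le_one) auto
    thus ?thesis using step[OF that, of n] by simp
  qed
  have "uniformly_convergent_on {0..1} (\<lambda>n t. \<Sum>i<n. Y (Suc i) t - Y i t)"
    by (rule Weierstrass_m_test'[where M = "\<lambda>n. D * (L ^ n / fact n)"])
      (use step' summable_exp[of L] in \<open>auto intro!: summable_mult simp: divide_inverse mult_ac\<close>)
  then obtain l where l: "uniform_limit {0..1} (\<lambda>n t. \<Sum>i<n. Y (Suc i) t - Y i t) l sequentially"
    by (auto simp: uniformly_convergent_on_def)
  define y where "y t = y0 + l t" for t
  have lim: "uniform_limit {0..1} Y y sequentially"
  proof -
    have "uniform_limit {0..1} (\<lambda>n t. y0 + (\<Sum>i<n. Y (Suc i) t - Y i t)) y sequentially"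
      unfolding y_def by (intro uniform_limit_add l uniform_limit_const)
    moreover have "(\<lambda>n t. y0 + (\<Sum>i<n. Y (Suc i) t - Y i t)) = Y"
    proof (intro ext)
      fix n t show "y0 + (\<Sum>i<n. Y (Suc i) t - Y i t) = Y n t"
        using sum_lessThan_telescope[of "\<lambda>i. Y i t" n] by (simp add: Y_0)
    qed
    ultimately show ?thesis by simp
  qed
  have y_cont: "continuous_on {0..1} y"
    by (rule uniform_limit_theorem[OF _ lim]) (auto intro!: always_eventually Y_cont)
  have y_eq: "y t = y0 + integral {0..t} (\<lambda>s. F s (y s))" if t: "t \<in> {0..1}" for t
  proof (rule ccontr)
    assume neq: "\<not> ?thesis"
    define g where "g = norm (y t - (y0 + integral {0..t} (\<lambda>s. F s (y s))))"
    have g: "g > 0" using neq by (simp add: g_def)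
    define e where "e = g / 2 / (1 + L)"
    have e: "e > 0" using g L by (simp add: e_def add_pos_nonneg)
    obtain n0 where n0: "\<And>n s. n \<ge> n0 \<Longrightarrow> s \<in> {0..1} \<Longrightarrow> dist (Y n s) (y s) < e"
      using lim e unfolding uniform_limit_sequentially_iff by blast
    have "norm (integral {0..t} (\<lambda>s. F s (Y n0 s)) - integral {0..t} (\<lambda>s. F s (y s)))
        = norm (integral {0..t} (\<lambda>s. F s (Y n0 s) - F s (y s)))"
      using t by (subst Henstock_Kurzweil_Integration.integral_diff) (auto intro!: integrable Y_cont y_cont)
    also have "\<dots> \<le> integral {0..t} (\<lambda>s. L * e)"
    proof (rule integral_norm_bound_integral)
      show "(\<lambda>s. F s (Y n0 s) - F s (y s)) integrable_on {0..t}"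
        using t by (intro Henstock_Kurzweil_Integration.integrable_diff integrable Y_cont y_cont) auto
      fix s assume "s \<in> {0..t}"
      hence s: "s \<in> {0..1}" using t by auto
      have "norm (F s (Y n0 s) - F s (y s)) \<le> L * norm (Y n0 s - y s)" by (rule lipL[OF s])
      also have "\<dots> \<le> L * e" using n0[OF order_refl s] L by (intro mult_left_mono) (auto simp: dist_norm)
      finally show "norm (F s (Y n0 s) - F s (y s)) \<le> L * e" .
    qed auto
    also have "\<dots> \<le> L * e" using t L e mult_right_mono[of t 1 "L * e"] by (simp add: mult_ac)
    finally have 1: "norm (integral {0..t} (\<lambda>s. F s (Y n0 s)) - integral {0..t} (\<lambda>s. F s (y s))) \<le> L * e" .
    have 2: "norm (Y (Suc n0) t - y t) < e" using n0[of "Suc n0" t] t by (simp add: dist_norm)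
    have "1 + L \<noteq> 0" using L by simp
    have "g = norm ((integral {0..t} (\<lambda>s. F s (Y n0 s)) - integral {0..t} (\<lambda>s. F s (y s)))
          - (Y (Suc n0) t - y t))"
      by (simp add: g_def Y_Suc algebra_simps)
    also have "\<dots> \<le> norm (integral {0..t} (\<lambda>s. F s (Y n0 s)) - integral {0..t} (\<lambda>s. F s (y s)))
          + norm (Y (Suc n0) t - y t)"
      by (rule norm_triangle_ineq4)
    also have "\<dots> < L * e + e" using 1 2 by linarith
    also have "L * e + e = (1 + L) * e" by (simp add: distrib_right)
    also have "\<dots> = g / 2" using nonzero_mult_div_cancel_left[OF \<open>1 + L \<noteq> 0\<close>, of "g / 2"]
      by (simp only: e_def times_divide_eq_right)
    finally show False using g by simp
  qed
  show ?thesis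
  proof
    show "y 0 = y0" using y_eq[of 0] by simp
    fix s :: real assume s: "s \<in> {0..1}"
    have "((\<lambda>t. y0 + integral {0..t} (\<lambda>s. F s (y s))) has_vector_derivative F s (y s)) (at s within {0..1})"
      by (auto intro!: derivative_eq_intros integral_has_vector_derivative cont y_cont s)
    thus "(y has_vector_derivative F s (y s)) (at s within {0..1})"
      by (rule has_vector_derivative_transform[OF s, rotated -1]) (simp add: y_eq)
  qed
qed

text \<open>The function \<open>exp (- (2 K + 1) s) |r s|\<^sup>2 - e\<^sup>2 s\<close> is nonincreasing. Squared norms are used because
  the norm itself need not be differentiable at a zero of \<open>r\<close>; the extra \<open>1\<close> in the exponent pays for
  the estimate \<open>2 |r| e \<le> |r|\<^sup>2 + e\<^sup>2\<close>.\<close>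
lemma gronwall_unit_interval:
  fixes r :: "real \<Rightarrow> 'a::real_inner" and K e :: real
  assumes der: "\<And>s. s \<in> {0..1} \<Longrightarrow> (r has_vector_derivative r' s) (at s within {0..1})"
    and bound: "\<And>s. s \<in> {0..1} \<Longrightarrow> norm (r' s) \<le> K * norm (r s) + e"
    and "K \<ge> 0" "t \<in> {0..1}"
  shows "(norm (r t))\<^sup>2 \<le> exp (2 * K + 1) * ((norm (r 0))\<^sup>2 + e\<^sup>2)"
proof -
  define M where "M = 2 * K + 1"
  define \<phi> where "\<phi> s = (r s \<bullet> r s) * exp (- M * s) - e\<^sup>2 * s" for s
  define \<phi>' where "\<phi>' s = (2 * (r s \<bullet> r' s) - M * (r s \<bullet> r s)) * exp (- M * s) - e\<^sup>2" for s
  have d: "(\<phi> has_real_derivative \<phi>' s) (at s within {0..1})" if "s \<in> {0..1}" for s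
  proof -
    have "((\<lambda>s. r s \<bullet> r s) has_vector_derivative (r s \<bullet> r' s + r' s \<bullet> r s)) (at s within {0..1})"
      by (rule bounded_bilinear.has_vector_derivative[OF bounded_bilinear_inner der[OF that] der[OF that]])
    hence "((\<lambda>s. r s \<bullet> r s) has_real_derivative (2 * (r s \<bullet> r' s))) (at s within {0..1})"
      by (simp add: has_real_derivative_iff_has_vector_derivative inner_commute)
    thus ?thesis unfolding \<phi>_def \<phi>'_def
      by (auto intro!: derivative_eq_intros simp: algebra_simps)
  qed
  have neg: "\<phi>' s \<le> 0" if s: "s \<in> {0..1}" for s
  proof -
    have "r s \<bullet> r' s \<le> norm (r s) * norm (r' s)" by (rule norm_cauchy_schwarz)
    also have "\<dots> \<le> norm (r s) * (K * norm (r s) + e)" by (intro mult_left_mono bound s) auto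
    finally have "2 * (r s \<bullet> r' s) \<le> 2 * K * (norm (r s))\<^sup>2 + 2 * norm (r s) * e"
      by (simp add: algebra_simps power2_eq_square)
    moreover have "2 * norm (r s) * e \<le> (norm (r s))\<^sup>2 + e\<^sup>2"
      using zero_le_power2[of "norm (r s) - e"] by (simp add: power2_eq_square algebra_simps)
    ultimately have "2 * (r s \<bullet> r' s) - M * (r s \<bullet> r s) \<le> e\<^sup>2"
      by (simp add: M_def algebra_simps power2_norm_eq_inner)
    hence "(2 * (r s \<bullet> r' s) - M * (r s \<bullet> r s)) * exp (- M * s) \<le> e\<^sup>2 * exp (- M * s)"
      by (intro mult_right_mono) auto
    also have "\<dots> \<le> e\<^sup>2 * 1"
      using s assms(3) by (intro mult_left_mono) (auto simp: M_def mult_le_0_iff)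
    finally show ?thesis by (simp add: \<phi>'_def)
  qed
  have "\<phi> t \<le> \<phi> 0"
  proof (rule DERIV_nonpos_imp_decreasing_open[of 0 t])
    show "0 \<le> t" using assms by simp
    show "continuous_on {0..t} \<phi>"
      by (rule continuous_on_subset[of "{0..1}"], rule DERIV_continuous_on[OF d]) (use assms in auto)
    fix x assume "0 < x" "x < t"
    moreover hence "at x within {0..1} = at x" using assms by (intro at_within_interior) auto
    ultimately show "\<exists>y. (\<phi> has_real_derivative y) (at x) \<and> y \<le> 0"
      using d[of x] neg[of x] assms by auto
  qed
  hence "(r t \<bullet> r t) * exp (- M * t) \<le> r 0 \<bullet> r 0 + e\<^sup>2 * t" by (simp add: \<phi>_def)
  also have "\<dots> \<le> r 0 \<bullet> r 0 + e\<^sup>2" using assms by (auto simp: mult_left_le)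
  finally have "(r t \<bullet> r t) * exp (- M * t) * exp (M * t) \<le> (r 0 \<bullet> r 0 + e\<^sup>2) * exp (M * t)"
    by (intro mult_right_mono) auto
  also have "\<dots> \<le> (r 0 \<bullet> r 0 + e\<^sup>2) * exp M"
    using assms by (intro mult_left_mono) (auto simp: M_def mult_left_le)
  also have "(r t \<bullet> r t) * exp (- M * t) * exp (M * t) = r t \<bullet> r t"
    by (simp add: mult.assoc flip: exp_add)
  finally show ?thesis
    by (simp add: M_def power2_norm_eq_inner mult.commute)
qed

lemma linear_ode_bound:
  fixes r :: "real \<Rightarrow> 'a::real_inner" and K :: real
  assumes der: "\<And>s. s \<in> {0..1} \<Longrightarrow> (r has_vector_derivative r' s) (at s within {0..1})"
    and bound: "\<And>s. s \<in> {0..1} \<Longrightarrow> norm (r' s) \<le> K * norm (r s) + e"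
    and "K \<ge> 0" "e \<ge> 0" "t \<in> {0..1}"
  shows "norm (r t) \<le> exp (K + 1) * (norm (r 0) + e)"
proof (rule power2_le_imp_le)
  have "(norm (r t))\<^sup>2 \<le> exp (2 * K + 1) * ((norm (r 0))\<^sup>2 + e\<^sup>2)"
    by (rule gronwall_unit_interval[OF der bound]) (use assms in auto)
  also have "\<dots> \<le> exp (2 * (K + 1)) * (norm (r 0) + e)\<^sup>2"
    using assms by (intro mult_mono) (auto simp: power2_eq_square algebra_simps)
  also have "\<dots> = (exp (K + 1) * (norm (r 0) + e))\<^sup>2"
    by (simp only: power_mult_distrib exp_double)
  finally show "(norm (r t))\<^sup>2 \<le> (exp (K + 1) * (norm (r 0) + e))\<^sup>2" .
qed (use assms in auto)

text \<open>If \<open>y\<close> depends differentiably on \<open>z\<close>, then \<open>V = \<partial>\<^sub>z y\<close> must satisfy the equation obtained by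
  differentiating \<open>\<partial>\<^sub>s y = (A + z C) y\<close> formally in \<open>z\<close>. Conversely, for any solution \<open>V\<close> of that
  variational equation with the correct initial value, Gronwall's inequality is applied twice:
  the difference \<open>y \<zeta> - y z\<close> is \<open>O (|\<zeta> - z|)\<close>, hence the remainder \<open>y \<zeta> - y z - (\<zeta> - z) V\<close>
  satisfies a linear equation whose inhomogeneity and initial value are \<open>o (|\<zeta> - z|)\<close>.\<close>
lemma parameter_derivative_linear_ode:
  fixes A C :: "real \<Rightarrow> 'a::real_inner \<Rightarrow> 'a" and y :: "real \<Rightarrow> real \<Rightarrow> 'a"
  assumes "open Z" "z \<in> Z" "bounded Z"
    and lin: "\<And>s. s \<in> {0..1} \<Longrightarrow> linear (A s)" "\<And>s. s \<in> {0..1} \<Longrightarrow> linear (C s)"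
    and bound: "\<And>s x. s \<in> {0..1} \<Longrightarrow> norm (A s x) \<le> K * norm x" 
      "\<And>s x. s \<in> {0..1} \<Longrightarrow> norm (C s x) \<le> K * norm x"
    and y: "\<And>\<zeta> s. \<zeta> \<in> Z \<Longrightarrow> s \<in> {0..1} \<Longrightarrow>
      (y \<zeta> has_vector_derivative A s (y \<zeta> s) + \<zeta> *\<^sub>R C s (y \<zeta> s)) (at s within {0..1})"
    and V: "\<And>s. s \<in> {0..1} \<Longrightarrow>
      (V has_vector_derivative A s (V s) + z *\<^sub>R C s (V s) + C s (y z s)) (at s within {0..1})"
    and init: "((\<lambda>\<zeta>. y \<zeta> 0) has_vector_derivative V 0) (at z)"
  shows "((\<lambda>\<zeta>. y \<zeta> 1) has_vector_derivative V 1) (at z)"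
proof -
  obtain R where R: "\<And>\<zeta>. \<zeta> \<in> Z \<Longrightarrow> \<bar>\<zeta>\<bar> \<le> R" using \<open>bounded Z\<close> by (auto simp: bounded_iff)
  have R0: "R \<ge> 0" using R[OF \<open>z \<in> Z\<close>] by simp
  define L where "L = \<bar>K\<bar> * (1 + R)"
  have L0: "L \<ge> 0" using R0 by (simp add: L_def)
  have KL: "K * norm x \<le> L * norm x" for x :: 'a
    using R0 abs_ge_self[of K] mult_left_mono[of 1 "1 + R" "\<bar>K\<bar>"] by (intro mult_right_mono) (auto simp: L_def)
  have N: "norm (A s x + \<zeta> *\<^sub>R C s x) \<le> L * norm x" if "s \<in> {0..1}" "\<zeta> \<in> Z" for s x \<zeta>
  proof -
    have "norm (A s x + \<zeta> *\<^sub>R C s x) \<le> norm (A s x) + \<bar>\<zeta>\<bar> * norm (C s x)"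
      by (metis norm_scaleR norm_triangle_ineq)
    also have "\<dots> \<le> \<bar>K\<bar> * norm x + R * (\<bar>K\<bar> * norm x)"
      using bound[OF that(1), of x] R[OF that(2)] abs_ge_self[of K]
      by (intro add_mono mult_mono) (auto intro: order_trans[OF _ mult_right_mono])
    finally show ?thesis by (simp add: L_def algebra_simps)
  qed
  define E where "E = exp (L + 1)"
  have E0: "E > 0" by (simp add: E_def)
  have size: "norm (y z s) \<le> E * norm (y z 0)" if "s \<in> {0..1}" for s
    using linear_ode_bound[OF y[OF \<open>z \<in> Z\<close>], where e = 0 and K = L and t = s] N[OF _ \<open>z \<in> Z\<close>] L0 that
    by (auto simp: E_def)
  define c where "c = L * (E * norm (y z 0))"
  have c0: "c \<ge> 0" using L0 E0 by (simp add: c_def)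
  have diff: "norm (y \<zeta> s - y z s) \<le> E * (norm (y \<zeta> 0 - y z 0) + \<bar>\<zeta> - z\<bar> * c)"
    if "\<zeta> \<in> Z" "s \<in> {0..1}" for \<zeta> s
  proof (rule linear_ode_bound[where r = "\<lambda>s. y \<zeta> s - y z s" and K = L, folded E_def])
    fix s :: real assume s: "s \<in> {0..1}"
    show "((\<lambda>s. y \<zeta> s - y z s) has_vector_derivative
        (A s (y \<zeta> s) + \<zeta> *\<^sub>R C s (y \<zeta> s)) - (A s (y z s) + z *\<^sub>R C s (y z s))) (at s within {0..1})"
      by (intro has_vector_derivative_diff y that s \<open>z \<in> Z\<close>)
    have "(A s (y \<zeta> s) + \<zeta> *\<^sub>R C s (y \<zeta> s)) - (A s (y z s) + z *\<^sub>R C s (y z s))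
        = (A s (y \<zeta> s - y z s) + \<zeta> *\<^sub>R C s (y \<zeta> s - y z s)) + (\<zeta> - z) *\<^sub>R C s (y z s)"
      by (simp add: linear_diff[OF lin(1)[OF s]] linear_diff[OF lin(2)[OF s]] algebra_simps)
    also have "norm \<dots> \<le> L * norm (y \<zeta> s - y z s) + \<bar>\<zeta> - z\<bar> * norm (C s (y z s))"
      by (rule order_trans[OF norm_triangle_ineq], rule add_mono[OF N[OF s \<open>\<zeta> \<in> Z\<close>]]) simp
    also have "\<dots> \<le> L * norm (y \<zeta> s - y z s) + \<bar>\<zeta> - z\<bar> * c"
    proof (intro add_left_mono mult_left_mono)
      have "norm (C s (y z s)) \<le> L * norm (y z s)" using bound(2)[OF s] KL order_trans by blast
      also have "\<dots> \<le> c" unfolding c_def using size[OF s] L0 by (intro mult_left_mono) auto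
      finally show "norm (C s (y z s)) \<le> c" .
    qed auto
    finally show "norm ((A s (y \<zeta> s) + \<zeta> *\<^sub>R C s (y \<zeta> s)) - (A s (y z s) + z *\<^sub>R C s (y z s)))
      \<le> L * norm (y \<zeta> s - y z s) + \<bar>\<zeta> - z\<bar> * c" .
  qed (use that L0 c0 in auto)
  define Q where "Q \<zeta> = norm (y \<zeta> 0 - y z 0) + \<bar>\<zeta> - z\<bar> * c" for \<zeta>
  have rem: "norm (y \<zeta> 1 - y z 1 - (\<zeta> - z) *\<^sub>R V 1)
      \<le> E * (norm (y \<zeta> 0 - y z 0 - (\<zeta> - z) *\<^sub>R V 0) + \<bar>\<zeta> - z\<bar> * (L * E * Q \<zeta>))"
    if "\<zeta> \<in> Z" for \<zeta>
  proof (rule linear_ode_bound[where r = "\<lambda>s. y \<zeta> s - y z s - (\<zeta> - z) *\<^sub>R V s" and K = L, folded E_def])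
    fix s :: real assume s: "s \<in> {0..1}"
    let ?r' = "(A s (y \<zeta> s) + \<zeta> *\<^sub>R C s (y \<zeta> s)) - (A s (y z s) + z *\<^sub>R C s (y z s))
       - (\<zeta> - z) *\<^sub>R (A s (V s) + z *\<^sub>R C s (V s) + C s (y z s))"
    let ?r = "y \<zeta> s - y z s - (\<zeta> - z) *\<^sub>R V s"
    show "((\<lambda>s. y \<zeta> s - y z s - (\<zeta> - z) *\<^sub>R V s) has_vector_derivative ?r') (at s within {0..1})"
      by (intro has_vector_derivative_diff bounded_linear.has_vector_derivative[OF bounded_linear_scaleR_right] y V that s \<open>z \<in> Z\<close>)
    have "?r' = (A s ?r + z *\<^sub>R C s ?r) + (\<zeta> - z) *\<^sub>R C s (y \<zeta> s - y z s)"
      by (simp add: linear_diff[OF lin(1)[OF s]] linear_diff[OF lin(2)[OF s]] 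
          linear_cmul[OF lin(1)[OF s]] linear_cmul[OF lin(2)[OF s]] linear_add[OF lin(1)[OF s]] linear_add[OF lin(2)[OF s]] algebra_simps)
    also have "norm \<dots> \<le> L * norm ?r + \<bar>\<zeta> - z\<bar> * norm (C s (y \<zeta> s - y z s))"
      by (rule order_trans[OF norm_triangle_ineq], rule add_mono[OF N[OF s \<open>z \<in> Z\<close>]]) simp
    also have "\<dots> \<le> L * norm ?r + \<bar>\<zeta> - z\<bar> * (L * E * Q \<zeta>)"
    proof (intro add_left_mono mult_left_mono)
      have "norm (C s (y \<zeta> s - y z s)) \<le> L * norm (y \<zeta> s - y z s)" using bound(2)[OF s] KL order_trans by blast
      also have "\<dots> \<le> L * (E * Q \<zeta>)" unfolding Q_def using diff[OF that s] L0 by (intro mult_left_mono) auto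
      finally show "norm (C s (y \<zeta> s - y z s)) \<le> L * E * Q \<zeta>" by simp
    qed auto
    finally show "norm ?r' \<le> L * norm ?r + \<bar>\<zeta> - z\<bar> * (L * E * Q \<zeta>)" .
  next
    show "0 \<le> \<bar>\<zeta> - z\<bar> * (L * E * Q \<zeta>)" using L0 c0 E0 by (auto simp: Q_def)
  qed (use L0 in auto)
  have lim0: "((\<lambda>\<zeta>. norm (y \<zeta> 0 - y z 0 - (\<zeta> - z) *\<^sub>R V 0) / \<bar>\<zeta> - z\<bar>) \<longlongrightarrow> 0) (at z)"
    using init unfolding has_vector_derivative_def has_derivative_iff_norm by simp
  have contq: "(Q \<longlongrightarrow> 0) (at z)"
  proof -
    have "((\<lambda>\<zeta>. y \<zeta> 0) \<longlongrightarrow> y z 0) (at z)"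
      using has_vector_derivative_continuous[OF init] by (simp add: continuous_within)
    hence "((\<lambda>\<zeta>. norm (y \<zeta> 0 - y z 0) + \<bar>\<zeta> - z\<bar> * c) \<longlongrightarrow> norm (y z 0 - y z 0) + \<bar>z - z\<bar> * c) (at z)"
      by (intro tendsto_intros)
    thus ?thesis unfolding Q_def by simp
  qed
  have "((\<lambda>\<zeta>. E * (norm (y \<zeta> 0 - y z 0 - (\<zeta> - z) *\<^sub>R V 0) / \<bar>\<zeta> - z\<bar> + L * E * Q \<zeta>)) \<longlongrightarrow> E * (0 + L * E * 0)) (at z)"
    by (intro tendsto_intros lim0 contq)
  hence lim1: "((\<lambda>\<zeta>. E * (norm (y \<zeta> 0 - y z 0 - (\<zeta> - z) *\<^sub>R V 0) / \<bar>\<zeta> - z\<bar> + L * E * Q \<zeta>)) \<longlongrightarrow> 0) (at z)"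
    by simp
  have "((\<lambda>\<zeta>. norm (y \<zeta> 1 - y z 1 - (\<zeta> - z) *\<^sub>R V 1) / \<bar>\<zeta> - z\<bar>) \<longlongrightarrow> 0) (at z)"
  proof (rule real_tendsto_sandwich[OF _ _ tendsto_const lim1])
    have "eventually (\<lambda>\<zeta>. \<zeta> \<in> Z) (at z)"
      using assms(1,2) by (simp add: eventually_at_in_open')
    moreover have "eventually (\<lambda>\<zeta>. \<zeta> \<noteq> z) (at z)" by (simp add: eventually_at_filter)
    ultimately show "\<forall>\<^sub>F \<zeta> in at z. norm (y \<zeta> 1 - y z 1 - (\<zeta> - z) *\<^sub>R V 1) / \<bar>\<zeta> - z\<bar>
        \<le> E * (norm (y \<zeta> 0 - y z 0 - (\<zeta> - z) *\<^sub>R V 0) / \<bar>\<zeta> - z\<bar> + L * E * Q \<zeta>)"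
    proof eventually_elim
      case (elim \<zeta>)
      have "norm (y \<zeta> 1 - y z 1 - (\<zeta> - z) *\<^sub>R V 1) / \<bar>\<zeta> - z\<bar>
        \<le> E * (norm (y \<zeta> 0 - y z 0 - (\<zeta> - z) *\<^sub>R V 0) + \<bar>\<zeta> - z\<bar> * (L * E * Q \<zeta>)) / \<bar>\<zeta> - z\<bar>"
        by (intro divide_right_mono rem elim) auto
      also have "\<dots> = E * (norm (y \<zeta> 0 - y z 0 - (\<zeta> - z) *\<^sub>R V 0) / \<bar>\<zeta> - z\<bar> + L * E * Q \<zeta>)"
        using elim by (simp add: field_simps)
      finally show ?case .
    qed
  qed auto
  thus ?thesis
    unfolding has_vector_derivative_def has_derivative_iff_norm
    by (simp add: bounded_linear_scaleR_left)
qed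

section \<open>Frobenius series at a regular singular point\<close>

text \<open>Solutions of recurrences whose \<open>n\<close>-th term depends linearly on all earlier terms: \<open>B n k\<close> is the
  contribution of term \<open>k\<close> to the \<open>n\<close>-th sum, and \<open>D n\<close> turns that sum into the \<open>n\<close>-th term.\<close>
fun course_of_values ::
    "(nat \<Rightarrow> nat \<Rightarrow> 'a \<Rightarrow> 'b::comm_monoid_add) \<Rightarrow> (nat \<Rightarrow> 'b \<Rightarrow> 'a) \<Rightarrow> nat \<Rightarrow> 'a" where
  "course_of_values B D n = D n (\<Sum>k<n. B n k (course_of_values B D k))"

declare course_of_values.simps [simp del]

text \<open>The growth condition that the Frobenius recurrence imposes on the coefficients. It expresses that
  \<open>e\<close> is dominated by the coefficients of a multiple of \<open>(1 - x) powr (- C)\<close>, for which equality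
  holds; in particular the radius of convergence is at least \<open>1\<close>.\<close>
definition averaged_growth :: "(nat \<Rightarrow> real) \<Rightarrow> bool" where
  "averaged_growth e \<longleftrightarrow> (\<forall>n. e n \<ge> 0) \<and> (\<exists>C\<ge>0. \<forall>n\<ge>1. real n * e n \<le> C * (\<Sum>k<n. e k))"

text \<open>The partial sums \<open>S n\<close> satisfy \<open>S (n + 1) \<le> (1 + C / (n + 1)) S n\<close>, so the ratio test applies to
  \<open>S n r\<^sup>n\<close>, which dominates \<open>e n r\<^sup>n\<close>.\<close>
lemma averaged_growth_summable:
  assumes "averaged_growth e" "0 \<le> r" "r < 1"
  shows "summable (\<lambda>n. e n * r ^ n)"
proof -
  have e0: "e n \<ge> 0" for n using assms(1) by (simp add: averaged_growth_def)
  obtain C where C: "C \<ge> 0" "\<And>n. n \<ge> 1 \<Longrightarrow> real n * e n \<le> C * (\<Sum>k<n. e k)"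
    using assms(1) unfolding averaged_growth_def by blast
  define S where "S n = (\<Sum>k<Suc n. e k)" for n
  have S0: "S n \<ge> 0" for n unfolding S_def by (intro sum_nonneg e0)
  have S_step: "S (Suc n) \<le> (1 + C / Suc n) * S n" for n
    using C(2)[of "Suc n"] unfolding S_def by (simp add: field_simps)
  obtain N :: nat where N: "2 * C / (1 - r) < N" using reals_Archimedean2 by blast
  have "summable (\<lambda>n. S n * r ^ n)"
  proof (rule summable_ratio_test[where c = "(1 + r) / 2" and N = N])
    show "(1 + r) / 2 < 1" using assms by simp
    fix n assume n: "N \<le> n"
    have "C / Suc n \<le> (1 - r) / 2"
    proof -
      have "2 * C < (1 - r) * Suc n"
      proof -
        have "2 * C < (1 - r) * N" using N assms by (simp add: field_simps)
        also have "\<dots> \<le> (1 - r) * Suc n" using n assms by (intro mult_left_mono) auto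
        finally show ?thesis .
      qed
      thus ?thesis by (simp add: field_simps)
    qed
    hence "(1 + C / Suc n) * r \<le> (1 + (1 - r) / 2) * r" using assms by (intro mult_right_mono) auto
    also have "\<dots> \<le> (1 + r) / 2"
      using sum_squares_ge_zero[of "1 - r" 0] by (simp add: field_simps)
    finally have "(1 + C / Suc n) * r \<le> (1 + r) / 2" .
    hence le: "(1 + C / Suc n) * r * (S n * r ^ n) \<le> (1 + r) / 2 * (S n * r ^ n)"
      using assms S0 by (intro mult_right_mono) auto
    have "S (Suc n) * r ^ Suc n \<le> (1 + C / Suc n) * S n * r ^ Suc n"
      using assms by (intro mult_right_mono S_step) auto
    also have "\<dots> = (1 + C / Suc n) * r * (S n * r ^ n)" by simp
    also note le
    finally have "S (Suc n) * r ^ Suc n \<le> (1 + r) / 2 * (S n * r ^ n)" .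
    thus "norm (S (Suc n) * r ^ Suc n) \<le> (1 + r) / 2 * norm (S n * r ^ n)"
      using S0 assms by (simp add: abs_mult)
  qed
  moreover have "norm (e n * r ^ n) \<le> S n * r ^ n" for n
  proof -
    have "e n * r ^ n \<le> S n * r ^ n"
      unfolding S_def using assms(2) by (intro mult_right_mono) (simp_all add: sum_nonneg e0)
    moreover have "0 \<le> e n * r ^ n" using e0 assms(2) by (intro mult_nonneg_nonneg) simp_all
    ultimately show ?thesis by (simp only: real_norm_def abs_of_nonneg)
  qed
  ultimately show ?thesis by (rule summable_comparison_test'[where N = 0])
qed

lemma averaged_growth_conv_radius:
  fixes f :: "complex fps"
  assumes "averaged_growth e" "\<And>n. norm (fps_nth f n) \<le> e n"
  shows "fps_conv_radius f \<ge> 1"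
  unfolding fps_conv_radius_def
proof (rule conv_radius_geI_ex)
  fix r :: real assume r: "0 < r" "ereal r < 1"
  have "summable (\<lambda>n. fps_nth f n * (of_real r) ^ n)"
    by (rule summable_comparison_test_ev[where g = "\<lambda>n. e n * r ^ n"],
        intro always_eventually allI)
      (use r assms averaged_growth_summable[of e r] in \<open>auto simp: norm_mult norm_power intro!: mult_right_mono\<close>)
  thus "\<exists>z. norm z = r \<and> summable (\<lambda>n. fps_nth f n * z ^ n)"
    using r by (intro exI[of _ "of_real r"]) auto
qed

text \<open>The expansion of \<open>r / (1 - z) + s\<close> at \<open>0\<close>, which is the form of every entry of the regular part of the
  coefficient matrix.\<close>
definition pole_kernel :: "complex \<Rightarrow> complex \<Rightarrow> complex fps" where
  "pole_kernel r s = fps_const r * Abs_fps (\<lambda>_. 1) + fps_const s"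

lemma pole_kernel_nth_bound: "norm (fps_nth (pole_kernel r s) n) \<le> norm r + norm s"
  unfolding pole_kernel_def by (cases n) (auto intro: norm_triangle_ineq)

lemma conv_radius_geometric: "fps_conv_radius (Abs_fps (\<lambda>_. 1 :: complex)) \<ge> 1"
proof (rule averaged_growth_conv_radius)
  show "averaged_growth (\<lambda>_. 1)" by (auto simp: averaged_growth_def intro!: exI[of _ 1])
qed simp

lemma eval_fps_geometric: "norm (z::complex) < 1 \<Longrightarrow> eval_fps (Abs_fps (\<lambda>_. 1)) z = 1 / (1 - z)"
  by (simp add: eval_fps_def suminf_geometric)

text \<open>The recurrence for the coefficients of a formal solution of a system with a regular singular point
  at \<open>0\<close>. The weights \<open>da\<close> and \<open>db\<close> stand for \<open>1 / (n - \<rho>)\<close>, except that they may be \<open>0\<close> at a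
  resonance \<open>n = \<rho>\<close>. The sequence \<open>H\<close> is carried along in the growth estimate so that the
  inhomogeneity may itself be the coefficient sequence of another solution.\<close>
lemma frobenius_recursion:
  fixes r11 r12 r21 r22 s11 s12 s21 s22 xi yi :: complex and da db ha hb :: "nat \<Rightarrow> complex"
  assumes d: "\<And>n. n \<ge> 1 \<Longrightarrow> real n * norm (da n) \<le> c" "\<And>n. n \<ge> 1 \<Longrightarrow> real n * norm (db n) \<le> c"
    and H: "averaged_growth H" "\<And>n. n \<ge> 1 \<Longrightarrow> norm (ha n) + norm (hb n) \<le> (\<Sum>k<n. H k)"
  obtains x y :: "complex fps" where
    "fps_nth x 0 = xi" "fps_nth y 0 = yi"
    "\<And>n. fps_nth x (Suc n) = da (Suc n) * (fps_nth (x * pole_kernel r11 s11 + y * pole_kernel r12 s12) n + ha (Suc n))"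
    "\<And>n. fps_nth y (Suc n) = db (Suc n) * (fps_nth (x * pole_kernel r21 s21 + y * pole_kernel r22 s22) n + hb (Suc n))"
    "averaged_growth (\<lambda>n. norm (fps_nth x n) + norm (fps_nth y n) + H n)"
proof -
  define B where "B n k p =
     (fst p * fps_nth (pole_kernel r11 s11) (n - Suc k) + snd p * fps_nth (pole_kernel r12 s12) (n - Suc k),
      fst p * fps_nth (pole_kernel r21 s21) (n - Suc k) + snd p * fps_nth (pole_kernel r22 s22) (n - Suc k))"
    for n k :: nat and p :: "complex \<times> complex"
  define D where "D n p = (if n = 0 then (xi, yi) else (da n * (fst p + ha n), db n * (snd p + hb n)))"
    for n :: nat and p :: "complex \<times> complex"
  define u where "u = course_of_values B D"
  have u: "u n = D n (\<Sum>k<n. B n k (u k))" for n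
    unfolding u_def by (subst course_of_values.simps) simp
  define x y where "x = Abs_fps (\<lambda>n. fst (u n))" and "y = Abs_fps (\<lambda>n. snd (u n))"
  have 0: "fps_nth x 0 = xi" "fps_nth y 0 = yi"
    by (simp_all add: x_def y_def u[of 0] D_def)
  have set: "{0..n} = {..<Suc n}" for n :: nat by auto
  have x: "fps_nth x (Suc n) = da (Suc n) * (fps_nth (x * pole_kernel r11 s11 + y * pole_kernel r12 s12) n + ha (Suc n))" for n
    using u[of "Suc n"]
    by (simp add: x_def y_def D_def fst_sum B_def fps_mult_nth sum.distrib set del: sum.lessThan_Suc)
  have y: "fps_nth y (Suc n) = db (Suc n) * (fps_nth (x * pole_kernel r21 s21 + y * pole_kernel r22 s22) n + hb (Suc n))" for n
    using u[of "Suc n"]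
    by (simp add: x_def y_def D_def snd_sum B_def fps_mult_nth sum.distrib set del: sum.lessThan_Suc)
  define K where "K = norm r11 + norm s11 + norm r12 + norm s12 + norm r21 + norm s21 + norm r22 + norm s22"
  have K0: "K \<ge> 0" by (simp add: K_def)
  have c0: "c \<ge> 0" by (rule order_trans[OF _ d(1)[of 1]]) simp_all
  define e where "e n = norm (fps_nth x n) + norm (fps_nth y n)" for n
  have conv: "norm (fps_nth (x * pole_kernel r s + y * pole_kernel r' s') n) \<le> (\<Sum>k<Suc n. (norm r + norm s) * norm (fps_nth x k) + (norm r' + norm s') * norm (fps_nth y k))"
    for r s r' s' n
  proof -
    have "norm (fps_nth (x * pole_kernel r s + y * pole_kernel r' s') n) =
        norm (\<Sum>k<Suc n. fps_nth x k * fps_nth (pole_kernel r s) (n - k) + fps_nth y k * fps_nth (pole_kernel r' s') (n - k))"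
      by (simp add: fps_mult_nth sum.distrib set del: sum.lessThan_Suc)
    also have "\<dots> \<le> (\<Sum>k<Suc n. (norm r + norm s) * norm (fps_nth x k) + (norm r' + norm s') * norm (fps_nth y k))"
      by (intro sum_norm_le order_trans[OF norm_triangle_ineq] add_mono)
        (simp_all add: norm_mult mult.commute mult_left_mono pole_kernel_nth_bound)
    finally show ?thesis .
  qed
  have sum2: "norm (fps_nth (x * pole_kernel r11 s11 + y * pole_kernel r12 s12) n)
      + norm (fps_nth (x * pole_kernel r21 s21 + y * pole_kernel r22 s22) n) \<le> K * (\<Sum>k<Suc n. e k)" for n
  proof -
    have "norm (fps_nth (x * pole_kernel r11 s11 + y * pole_kernel r12 s12) n)
      + norm (fps_nth (x * pole_kernel r21 s21 + y * pole_kernel r22 s22) n)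
      \<le> (\<Sum>k<Suc n. ((norm r11 + norm s11) * norm (fps_nth x k) + (norm r12 + norm s12) * norm (fps_nth y k))
         + ((norm r21 + norm s21) * norm (fps_nth x k) + (norm r22 + norm s22) * norm (fps_nth y k)))"
      unfolding sum.distrib[of _ _ "{..<Suc n}"] using conv[of r11 s11 r12 s12 n] conv[of r21 s21 r22 s22 n]
      unfolding sum.distrib[of _ _ "{..<Suc n}"] by (intro add_mono)
    also have "\<dots> \<le> (\<Sum>k<Suc n. K * e k)"
    proof (rule sum_mono)
      fix k
      have "0 \<le> norm (fps_nth x k) * (norm r12 + norm s12 + norm r22 + norm s22)"
        "0 \<le> norm (fps_nth y k) * (norm r11 + norm s11 + norm r21 + norm s21)"
        by (intro mult_nonneg_nonneg; simp)+
      thus "((norm r11 + norm s11) * norm (fps_nth x k) + (norm r12 + norm s12) * norm (fps_nth y k))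
         + ((norm r21 + norm s21) * norm (fps_nth x k) + (norm r22 + norm s22) * norm (fps_nth y k)) \<le> K * e k"
        by (simp add: K_def e_def algebra_simps)
    qed
    finally show ?thesis by (simp only: sum_distrib_left)
  qed
  obtain C where C: "C \<ge> 0" "\<And>n. n \<ge> 1 \<Longrightarrow> real n * H n \<le> C * (\<Sum>k<n. H k)" and H0: "\<And>n. H n \<ge> 0"
    using H(1) unfolding averaged_growth_def by blast
  have "averaged_growth (\<lambda>n. e n + H n)"
    unfolding averaged_growth_def
  proof (intro conjI exI[of _ "c * (K + 1) + C"] allI impI)
    show "0 \<le> e n + H n" for n using H0[of n] by (simp add: e_def)
    show "0 \<le> c * (K + 1) + C" using c0 K0 C by simp
    fix n :: nat assume "1 \<le> n"
    then obtain m where n: "n = Suc m" by (cases n) auto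
    define p1 where "p1 = fps_nth (x * pole_kernel r11 s11 + y * pole_kernel r12 s12) m + ha n"
    define p2 where "p2 = fps_nth (x * pole_kernel r21 s21 + y * pole_kernel r22 s22) m + hb n"
    have E0: "(\<Sum>k<n. e k) \<ge> 0" "(\<Sum>k<n. H k) \<ge> 0" by (auto simp: e_def H0 intro!: sum_nonneg)
    have "real n * e n = (real n * norm (da n)) * norm p1 + (real n * norm (db n)) * norm p2"
    proof -
      have "fps_nth x n = da n * p1" "fps_nth y n = db n * p2"
        unfolding n x y by (simp_all add: p1_def p2_def n)
      thus ?thesis by (simp add: e_def norm_mult distrib_left)
    qed
    also have "\<dots> \<le> c * norm p1 + c * norm p2"
      using d[OF \<open>1 \<le> n\<close>] by (intro add_mono mult_right_mono) auto
    also have "\<dots> = c * (norm p1 + norm p2)" by (simp add: algebra_simps)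
    also have "norm p1 + norm p2 \<le> K * (\<Sum>k<n. e k) + (\<Sum>k<n. H k)"
      using sum2[of m] H(2)[OF \<open>1 \<le> n\<close>]
        norm_triangle_ineq[of "fps_nth (x * pole_kernel r11 s11 + y * pole_kernel r12 s12) m" "ha n"]
        norm_triangle_ineq[of "fps_nth (x * pole_kernel r21 s21 + y * pole_kernel r22 s22) m" "hb n"]
      unfolding p1_def p2_def n by linarith
    also have "\<dots> \<le> (K + 1) * (\<Sum>k<n. e k + H k)"
      using E0 K0 by (simp add: sum.distrib algebra_simps)
    finally have 1: "real n * e n \<le> c * ((K + 1) * (\<Sum>k<n. e k + H k))" using c0 by (simp add: mult_left_mono)
    have "real n * H n \<le> C * (\<Sum>k<n. H k)" by (rule C(2)[OF \<open>1 \<le> n\<close>])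
    also have "\<dots> \<le> C * (\<Sum>k<n. e k + H k)"
      using C(1) E0 by (intro mult_left_mono) (auto simp: sum.distrib)
    finally show "real n * (e n + H n) \<le> (c * (K + 1) + C) * (\<Sum>k<n. e k + H k)"
      using 1 by (simp add: algebra_simps)
  qed
  thus ?thesis using that[OF 0 x y] by (simp add: e_def)
qed


text \<open>Comparing coefficients: the recurrence is the differential equation multiplied by \<open>z\<close>.\<close>
lemma frobenius_equation:
  fixes x y1 y2 k1 k2 h :: "complex fps" and \<rho> :: complex
  assumes rec: "\<And>n. n \<ge> 1 \<Longrightarrow> (of_nat n - \<rho>) * fps_nth x n = fps_nth (y1 * k1 + y2 * k2) (n - 1) + fps_nth h n"
    and "\<rho> * fps_nth x 0 = 0" "fps_nth h 0 = 0"
  shows "fps_X * fps_deriv x = fps_const \<rho> * x + fps_X * (y1 * k1 + y2 * k2) + h"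
proof (rule fps_ext)
  fix n
  show "fps_nth (fps_X * fps_deriv x) n = fps_nth (fps_const \<rho> * x + fps_X * (y1 * k1 + y2 * k2) + h) n"
    using rec[of n] assms(2,3) by (cases n) (auto simp: algebra_simps simp del: fps_add_nth, auto simp: algebra_simps)
qed

lemma eval_frobenius_equation:
  fixes x y1 y2 h :: "complex fps" and \<rho> :: complex
  assumes eq: "fps_X * fps_deriv x = fps_const \<rho> * x + fps_X * (y1 * pole_kernel r s + y2 * pole_kernel r' s') + h"
    and rad: "fps_conv_radius x \<ge> 1" "fps_conv_radius y1 \<ge> 1" "fps_conv_radius y2 \<ge> 1" "fps_conv_radius h \<ge> 1"
    and z: "norm z < 1" "z \<noteq> 0"
  shows "(eval_fps x has_field_derivative \<rho> / z * eval_fps x z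
     + ((r / (1 - z) + s) * eval_fps y1 z + (r' / (1 - z) + s') * eval_fps y2 z) + eval_fps h z / z) (at z)"
proof -
  have less: "ereal (norm z) < fps_conv_radius f" if "fps_conv_radius f \<ge> 1" for f :: "complex fps"
    using that z(1) by (metis ereal_less(3) less_le_trans)
  have mult: "fps_conv_radius (f * g) \<ge> 1" if "fps_conv_radius f \<ge> 1" "fps_conv_radius g \<ge> 1" for f g :: "complex fps"
    using fps_conv_radius_mult[of f g] that by (meson min.boundedI order_trans)
  have add: "fps_conv_radius (f + g) \<ge> 1" if "fps_conv_radius f \<ge> 1" "fps_conv_radius g \<ge> 1" for f g :: "complex fps"
    using fps_conv_radius_add[of f g] that by (meson min.boundedI order_trans)
  have K: "fps_conv_radius (pole_kernel a b) \<ge> 1" for a b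
    unfolding pole_kernel_def by (intro add mult conv_radius_geometric) simp_all
  have Keval: "eval_fps (pole_kernel a b) z = a / (1 - z) + b" for a b
    unfolding pole_kernel_def using z
    by (simp add: eval_fps_add eval_fps_mult eval_fps_geometric less mult conv_radius_geometric)
  have D: "fps_conv_radius (fps_deriv x) \<ge> 1" using rad(1) fps_conv_radius_deriv order_trans by blast
  have "eval_fps (fps_X * fps_deriv x) z
     = eval_fps (fps_const \<rho> * x + fps_X * (y1 * pole_kernel r s + y2 * pole_kernel r' s') + h) z" by (simp only: eq)
  hence "z * eval_fps (fps_deriv x) z = \<rho> * eval_fps x z
     + z * (eval_fps y1 z * (r / (1 - z) + s) + eval_fps y2 z * (r' / (1 - z) + s')) + eval_fps h z"
    by (simp add: eval_fps_add eval_fps_mult Keval less mult add K D rad)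
  hence "z * eval_fps (fps_deriv x) z / z = (\<rho> * eval_fps x z
     + z * (eval_fps y1 z * (r / (1 - z) + s) + eval_fps y2 z * (r' / (1 - z) + s')) + eval_fps h z) / z"
    by simp
  hence "eval_fps (fps_deriv x) z = (\<rho> * eval_fps x z
     + z * (eval_fps y1 z * (r / (1 - z) + s) + eval_fps y2 z * (r' / (1 - z) + s')) + eval_fps h z) / z"
    using z by simp
  also have "\<dots> = \<rho> / z * eval_fps x z
     + ((r / (1 - z) + s) * eval_fps y1 z + (r' / (1 - z) + s') * eval_fps y2 z) + eval_fps h z / z"
    using z by (simp add: add_divide_distrib mult.commute)
  finally show ?thesis using has_field_derivative_eval_fps[OF less[OF rad(1)]] by simp
qed

text \<open>One column of the holomorphic factor of a fundamental matrix. After the substitution of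
  \<open>y = z powr \<rho> f\<close> into \<open>y' = (diag (-\<alpha>, \<alpha>) / z + R / (1 - z) + S) y\<close>, the numbers \<open>\<rho>1\<close> and
  \<open>\<rho>2\<close> are the differences between the diagonal entries and \<open>\<rho>\<close>; the terms \<open>h1\<close> and \<open>h2\<close> account
  for a logarithm.\<close>
definition frobenius_column ::
  "complex \<Rightarrow> complex \<Rightarrow> complex^2^2 \<Rightarrow> complex^2^2 \<Rightarrow> (complex \<Rightarrow> complex) \<Rightarrow>
   (complex \<Rightarrow> complex) \<Rightarrow> (complex \<Rightarrow> complex) \<Rightarrow>
   (complex \<Rightarrow> complex) \<Rightarrow> bool" where
  "frobenius_column \<rho>1 \<rho>2 R S h1 h2 f1 f2 \<longleftrightarrow> f1 holomorphic_on ball 0 1 \<and> f2 holomorphic_on ball 0 1 \<and>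
     (\<forall>z\<in>ball 0 1 - {0}.
       (f1 has_field_derivative \<rho>1 / z * f1 z +
          ((R$1$1 / (1 - z) + S$1$1) * f1 z + (R$1$2 / (1 - z) + S$1$2) * f2 z) + h1 z / z) (at z) \<and>
       (f2 has_field_derivative \<rho>2 / z * f2 z +
          ((R$2$1 / (1 - z) + S$2$1) * f1 z + (R$2$2 / (1 - z) + S$2$2) * f2 z) + h2 z / z) (at z))"

lemma frobenius_column_eval_fps:
  fixes x y h1 h2 :: "complex fps"
  assumes "\<And>n. n \<ge> 1 \<Longrightarrow> (of_nat n - \<rho>1) * fps_nth x n =
      fps_nth (x * pole_kernel (R$1$1) (S$1$1) + y * pole_kernel (R$1$2) (S$1$2)) (n - 1) + fps_nth h1 n"
    "\<And>n. n \<ge> 1 \<Longrightarrow> (of_nat n - \<rho>2) * fps_nth y n =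
      fps_nth (x * pole_kernel (R$2$1) (S$2$1) + y * pole_kernel (R$2$2) (S$2$2)) (n - 1) + fps_nth h2 n"
    "\<rho>1 * fps_nth x 0 = 0" "\<rho>2 * fps_nth y 0 = 0" "fps_nth h1 0 = 0" "fps_nth h2 0 = 0"
    and rad: "fps_conv_radius x \<ge> 1" "fps_conv_radius y \<ge> 1" "fps_conv_radius h1 \<ge> 1" "fps_conv_radius h2 \<ge> 1"
  shows "frobenius_column \<rho>1 \<rho>2 R S (eval_fps h1) (eval_fps h2) (eval_fps x) (eval_fps y)"
proof -
  have "ball 0 1 = eball (0::complex) 1" by (simp add: one_ereal_def)
  hence "ball (0::complex) 1 \<subseteq> eball 0 (fps_conv_radius f)" if "fps_conv_radius f \<ge> 1" for f :: "complex fps"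
    using eball_mono[OF that] by simp
  hence hol: "eval_fps f holomorphic_on ball 0 1" if "fps_conv_radius f \<ge> 1" for f :: "complex fps"
    using that by (intro holomorphic_on_eval_fps)
  show ?thesis unfolding frobenius_column_def
    by (intro conjI ballI hol rad; rule eval_frobenius_equation[OF frobenius_equation])
      (use assms in auto)
qed

text \<open>The column \<open>g\<close> belongs to the larger exponent \<open>\<alpha>\<close> and has no resonance. The column \<open>f\<close> belongs to
  \<open>-\<alpha>\<close>; if \<open>2 \<alpha>\<close> is a natural number \<open>N\<close>, then the equation for the \<open>N\<close>-th coefficient of \<open>f2\<close>
  cannot be solved in general, and \<open>q\<close> is chosen such that the logarithmic term \<open>q z\<^sup>N g\<close>
  compensates the defect.\<close>
lemma frobenius_columns_exist:
  fixes \<alpha> :: real and R S :: "complex^2^2"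
  assumes "\<alpha> > 0"
  obtains q N f1 f2 g1 g2 where
    "q \<noteq> 0 \<Longrightarrow> real N = 2 * \<alpha>" "N \<ge> 1"
    "f1 0 = 1" "f2 0 = 0" "g1 0 = 0" "g2 0 = 1"
    "frobenius_column (- 2 * of_real \<alpha>) 0 R S (\<lambda>_. 0) (\<lambda>_. 0) g1 g2"
    "frobenius_column 0 (2 * of_real \<alpha>) R S (\<lambda>z. - q * z ^ N * g1 z) (\<lambda>z. - q * z ^ N * g2 z) f1 f2"
proof -
  define k where "k i j = pole_kernel (R$i$j) (S$i$j)" for i j
  have H0: "averaged_growth (\<lambda>_. 0)" unfolding averaged_growth_def by auto
  have bound_g: "real n * norm (1 / (of_nat n + 2 * of_real \<alpha> :: complex)) \<le> 1" for n
  proof -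
    have "norm (of_nat n + 2 * of_real \<alpha> :: complex) = real n + 2 * \<alpha>"
      using assms norm_of_real[of "real n + 2 * \<alpha>", where 'a = complex] by simp
    thus ?thesis using assms by (simp add: norm_divide)
  qed
  obtain x y where g: "fps_nth x 0 = 0" "fps_nth y 0 = 1"
    "\<And>n. fps_nth x (Suc n) = 1 / (of_nat (Suc n) + 2 * of_real \<alpha>) * (fps_nth (x * k 1 1 + y * k 1 2) n + 0)"
    "\<And>n. fps_nth y (Suc n) = 1 / of_nat (Suc n) * (fps_nth (x * k 2 1 + y * k 2 2) n + 0)"
    "averaged_growth (\<lambda>n. norm (fps_nth x n) + norm (fps_nth y n) + 0)"
    unfolding k_def
    by (rule frobenius_recursion[where xi = 0 and yi = 1 and c = 1 and H = "\<lambda>_. 0"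
          and da = "\<lambda>n. 1 / (of_nat n + 2 * of_real \<alpha>)" and db = "\<lambda>n. 1 / of_nat n" and ha = "\<lambda>_. 0" and hb = "\<lambda>_. 0"])
      (use bound_g H0 in \<open>auto simp: norm_divide\<close>)
  have rad_g: "fps_conv_radius x \<ge> 1" "fps_conv_radius y \<ge> 1"
    by (rule averaged_growth_conv_radius[OF g(5)]; simp)+
  have ng: "of_nat n + 2 * of_real \<alpha> \<noteq> (0::complex)" for n
  proof
    assume "of_nat n + 2 * of_real \<alpha> = (0::complex)"
    hence "of_real (real n + 2 * \<alpha>) = (0::complex)" by simp
    hence "real n + 2 * \<alpha> = 0" by (simp only: of_real_eq_0_iff)
    thus False using assms by simp
  qed
  have G: "frobenius_column (- 2 * of_real \<alpha>) 0 R S (\<lambda>_. 0) (\<lambda>_. 0) (eval_fps x) (eval_fps y)"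
  proof -
    have "frobenius_column (- 2 * of_real \<alpha>) 0 R S (eval_fps 0) (eval_fps 0) (eval_fps x) (eval_fps y)"
    proof (rule frobenius_column_eval_fps)
      fix n :: nat assume "n \<ge> 1"
      then obtain m where n: "n = Suc m" by (cases n) auto
      show "(of_nat n - - 2 * of_real \<alpha>) * fps_nth x n = fps_nth (x * pole_kernel (R$1$1) (S$1$1) + y * pole_kernel (R$1$2) (S$1$2)) (n - 1) + fps_nth 0 n"
        using g(3)[of m] ng[of n] unfolding n k_def by (simp del: of_nat_Suc)
      show "(of_nat n - 0) * fps_nth y n = fps_nth (x * pole_kernel (R$2$1) (S$2$1) + y * pole_kernel (R$2$2) (S$2$2)) (n - 1) + fps_nth 0 n"
        using g(4)[of m] unfolding n k_def by (simp del: of_nat_Suc)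
    qed (use g rad_g in auto)
    moreover have "eval_fps 0 = (\<lambda>_::complex. 0)" by (rule ext) simp
    ultimately show ?thesis by (simp only:)
  qed
  define d where "d n = (if real n = 2 * \<alpha> then 0 else 1 / (of_nat n - 2 * of_real \<alpha>) :: complex)" for n
  have nonres: "of_nat n - 2 * of_real \<alpha> \<noteq> (0::complex)" if "real n \<noteq> 2 * \<alpha>" for n
  proof
    assume "of_nat n - 2 * of_real \<alpha> = (0::complex)"
    hence "of_real (real n - 2 * \<alpha>) = (0::complex)" by simp
    hence "real n - 2 * \<alpha> = 0" by (simp only: of_real_eq_0_iff)
    thus False using that by simp
  qed
  obtain c where c: "\<And>n. real n * norm (d n) \<le> c" "c \<ge> 1"
  proof -
    have nd: "real n * norm (d n) = (if real n = 2 * \<alpha> then 0 else real n / \<bar>real n - 2 * \<alpha>\<bar>)" for n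
      using norm_of_real[of "real n - 2 * \<alpha>", where 'a = complex] by (simp add: d_def norm_divide)
    obtain n0 :: nat where n0: "4 * \<alpha> < n0" using reals_Archimedean2 by blast
    define c where "c = max 2 (Max ((\<lambda>n. real n * norm (d n)) ` {..n0}))"
    have "real n * norm (d n) \<le> c" for n
    proof (cases "n \<le> n0")
      case True
      hence "real n * norm (d n) \<le> Max ((\<lambda>n. real n * norm (d n)) ` {..n0})" by (intro Max_ge) auto
      thus ?thesis by (simp add: c_def)
    next
      case False
      hence "real n > 4 * \<alpha>" using n0 by linarith
      hence "real n * norm (d n) \<le> 2" unfolding nd using assms by (auto simp: field_simps abs_if)
      thus ?thesis by (simp add: c_def)
    qed
    moreover have "c \<ge> 1" by (simp add: c_def)
    ultimately show ?thesis by (rule that)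
  qed
  \<comment> \<open>Without a resonance \<open>q = 0\<close>, and \<open>1\<close> is an arbitrary positive default.\<close>
  define N where "N = (if 2 * \<alpha> \<in> \<nat> then nat \<lfloor>2 * \<alpha>\<rfloor> else 1)"
  have N: "real N = 2 * \<alpha>" if "real n = 2 * \<alpha>" for n
  proof -
    have "2 * \<alpha> \<in> \<nat>" unfolding that[symmetric] by simp
    thus ?thesis unfolding N_def that[symmetric] by simp
  qed
  have N1: "N \<ge> 1"
  proof (cases "2 * \<alpha> \<in> \<nat>")
    case True
    then obtain n where "2 * \<alpha> = real n" by (auto elim: Nats_cases)
    thus ?thesis using N[of n] assms by (cases N) auto
  qed (simp add: N_def)
  define H where "H Q n = norm Q * (norm (fps_nth x n) + norm (fps_nth y n))" for Q :: complex and n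
  have H: "averaged_growth (H Q)" for Q
  proof -
    obtain C where C: "C \<ge> 0" "\<And>n. n \<ge> 1 \<Longrightarrow> real n * (norm (fps_nth x n) + norm (fps_nth y n)) \<le> C * (\<Sum>k<n. norm (fps_nth x k) + norm (fps_nth y k))"
      using g(5) by (auto simp: averaged_growth_def)
    have "real n * H Q n \<le> C * (\<Sum>k<n. H Q k)" if "n \<ge> 1" for n
      using mult_left_mono[OF C(2)[OF that], of "norm Q"] by (simp add: H_def sum_distrib_left mult_ac)
    thus ?thesis using C(1) unfolding averaged_growth_def by (auto simp: H_def)
  qed
  define h where "h Q v = fps_const (- Q) * (fps_X ^ N * v)" for Q :: complex and v
  have h_nth: "fps_nth (h Q v) n = (if n < N then 0 else - Q * fps_nth v (n - N))" for Q v n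
    by (simp add: h_def fps_X_power_mult_nth)
  have hH: "norm (fps_nth (h Q x) n) + norm (fps_nth (h Q y) n) \<le> (\<Sum>k<n. H Q k)" for n Q
  proof (cases "n < N")
    case True
    thus ?thesis by (simp add: h_nth H_def sum_nonneg)
  next
    case False
    hence "norm (fps_nth (h Q x) n) + norm (fps_nth (h Q y) n) = H Q (n - N)"
      by (simp add: h_nth H_def norm_mult distrib_left)
    also have "\<dots> \<le> (\<Sum>k<n. H Q k)"
      using False N1 by (intro member_le_sum) (auto simp: H_def)
    finally show ?thesis .
  qed
  define sol where "sol Q u v \<longleftrightarrow> fps_nth u 0 = 1 \<and> fps_nth v 0 = 0 \<and>
    (\<forall>n. fps_nth u (Suc n) = 1 / of_nat (Suc n) * (fps_nth (u * k 1 1 + v * k 1 2) n + fps_nth (h Q x) (Suc n))) \<and>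
    (\<forall>n. fps_nth v (Suc n) = d (Suc n) * (fps_nth (u * k 2 1 + v * k 2 2) n + fps_nth (h Q y) (Suc n))) \<and>
    averaged_growth (\<lambda>n. norm (fps_nth u n) + norm (fps_nth v n) + H Q n)" for Q u v
  have "\<exists>u v. sol Q u v" for Q
    unfolding sol_def k_def
    by (rule frobenius_recursion[where xi = 1 and yi = 0 and c = c and H = "H Q"
          and db = d and da = "\<lambda>n. 1 / of_nat n" and ha = "fps_nth (h Q x)" and hb = "fps_nth (h Q y)"])
      (use c H hH in \<open>auto simp: norm_divide\<close>)
  then obtain u v where "\<And>Q. sol Q (u Q) (v Q)" by metis
  hence uv: "fps_nth (u Q) 0 = 1" "fps_nth (v Q) 0 = 0"
    "fps_nth (u Q) (Suc n) = 1 / of_nat (Suc n) * (fps_nth (u Q * k 1 1 + v Q * k 1 2) n + fps_nth (h Q x) (Suc n))"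
    "fps_nth (v Q) (Suc n) = d (Suc n) * (fps_nth (u Q * k 2 1 + v Q * k 2 2) n + fps_nth (h Q y) (Suc n))"
    "averaged_growth (\<lambda>n. norm (fps_nth (u Q) n) + norm (fps_nth (v Q) n) + H Q n)" for Q n
    unfolding sol_def by blast+
  \<comment> \<open>The inhomogeneity starts at order \<open>N\<close>, so the coefficients below \<open>N\<close> do not depend on \<open>Q\<close>; hence the defect at order \<open>N\<close> can be read off at \<open>Q = 0\<close>.\<close>
  have agree: "fps_nth (u Q) n = fps_nth (u 0) n \<and> fps_nth (v Q) n = fps_nth (v 0) n" if "n < N" for Q n
    using that
  proof (induction n rule: less_induct)
    case (less n)
    show ?case
    proof (cases n)
      case 0
      thus ?thesis using uv(1,2) by simp
    next
      case (Suc m)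
      have "fps_nth (u Q * f + v Q * f') m = fps_nth (u 0 * f + v 0 * f') m" for f f'
        using less Suc by (auto simp: fps_mult_nth intro!: arg_cong2[where f = "(+)"] sum.cong)
      thus ?thesis using less.prems unfolding Suc uv(3,4) by (simp add: h_nth)
    qed
  qed
  define q where "q = (if real N = 2 * \<alpha> then fps_nth (u 0 * k 2 1 + v 0 * k 2 2) (N - 1) else 0)"
  have rad_f: "fps_conv_radius (u q) \<ge> 1" "fps_conv_radius (v q) \<ge> 1"
    by (rule averaged_growth_conv_radius[OF uv(5)[of q]]; simp add: H_def)+
  have mult: "fps_conv_radius (f * g) \<ge> 1" if "fps_conv_radius f \<ge> 1" "fps_conv_radius g \<ge> 1" for f g :: "complex fps"
    using fps_conv_radius_mult[of f g] that by (meson min.boundedI order_trans)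
  have rad_h: "fps_conv_radius (h q w) \<ge> 1" if "fps_conv_radius w \<ge> 1" for w
    unfolding h_def using that by (intro mult) auto
  have "frobenius_column 0 (2 * of_real \<alpha>) R S (eval_fps (h q x)) (eval_fps (h q y)) (eval_fps (u q)) (eval_fps (v q))"
  proof (rule frobenius_column_eval_fps)
    fix n :: nat assume "n \<ge> 1"
    then obtain m where n: "n = Suc m" by (cases n) auto
    show "(of_nat n - 0) * fps_nth (u q) n = fps_nth (u q * pole_kernel (R$1$1) (S$1$1) + v q * pole_kernel (R$1$2) (S$1$2)) (n - 1) + fps_nth (h q x) n"
      using uv(3)[of q m] unfolding n k_def by (simp del: of_nat_Suc)
    show "(of_nat n - 2 * of_real \<alpha>) * fps_nth (v q) n = fps_nth (u q * pole_kernel (R$2$1) (S$2$1) + v q * pole_kernel (R$2$2) (S$2$2)) (n - 1) + fps_nth (h q y) n"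
    proof (cases "real n = 2 * \<alpha>")
      case False
      thus ?thesis using uv(4)[of q m] nonres[OF False] unfolding n k_def by (simp add: d_def del: of_nat_Suc)
    next
      case True
      hence "real N = real n" using N[OF True] by simp
      hence nN: "n = N" by simp
      have "fps_nth (u q * f + v q * f') (N - 1) = fps_nth (u 0 * f + v 0 * f') (N - 1)" for f f'
        using agree[of _ q] N1 by (auto simp: fps_mult_nth intro!: arg_cong2[where f = "(+)"] sum.cong)
      hence "fps_nth (u q * k 2 1 + v q * k 2 2) (N - 1) = q" using True nN by (simp add: q_def)
      moreover have "fps_nth (h q y) N = - q" using g(2) by (simp add: h_nth)
      moreover have "of_nat n - 2 * of_real \<alpha> = (0::complex)"
        using True by (metis of_real_of_nat_eq of_real_mult of_real_numeral right_minus_eq)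
      ultimately show ?thesis by (simp add: nN k_def)
    qed
  qed (use uv N1 rad_f rad_g rad_h in \<open>auto simp: h_nth\<close>)
  moreover have "eval_fps (h q w) z = - q * z ^ N * eval_fps w z" if "fps_conv_radius w \<ge> 1" "norm z < 1" for w z
  proof -
    have less: "ereal (norm z) < fps_conv_radius f" if "fps_conv_radius f \<ge> 1" for f :: "complex fps"
      using that \<open>norm z < 1\<close> by (metis ereal_less(3) less_le_trans)
    show ?thesis unfolding h_def using that
      by (simp add: eval_fps_mult less mult)
  qed
  ultimately have F: "frobenius_column 0 (2 * of_real \<alpha>) R S (\<lambda>z. - q * z ^ N * eval_fps x z) (\<lambda>z. - q * z ^ N * eval_fps y z) (eval_fps (u q)) (eval_fps (v q))"
    using rad_g unfolding frobenius_column_def by auto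
  show ?thesis
    by (rule that[OF _ N1 _ _ _ _ G F]) (use uv g in \<open>auto simp: q_def eval_fps_at_0 split: if_splits\<close>)
qed

section \<open>Two-by-two matrices\<close>

text \<open>Applied twice, this gives the entrywise criterion for matrices.\<close>
lemma has_vector_derivative_vecI:
  fixes f :: "real \<Rightarrow> 'b::euclidean_space^'n"
  assumes "\<And>i. ((\<lambda>x. f x $ i) has_vector_derivative D $ i) (at x within S)"
  shows "(f has_vector_derivative D) (at x within S)"
  unfolding has_vector_derivative_def
proof (subst has_derivative_componentwise_within, rule ballI)
  fix u :: "'b^'n" assume "u \<in> Basis"
  then obtain i b where u: "u = axis i b" "b \<in> Basis" by (auto simp: Basis_vec_def)
  have "((\<lambda>x. f x $ i \<bullet> b) has_derivative (\<lambda>h. (h *\<^sub>R D $ i) \<bullet> b)) (at x within S)"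
    using assms[of i] unfolding has_vector_derivative_def by (rule has_derivative_inner_left)
  thus "((\<lambda>x. f x \<bullet> u) has_derivative (\<lambda>h. (h *\<^sub>R D) \<bullet> u)) (at x within S)"
    by (simp add: u inner_axis)
qed

lemma has_vector_derivative_vec_nth:
  "(f has_vector_derivative D) F \<Longrightarrow> ((\<lambda>x. f x $ i) has_vector_derivative D $ i) F"
  by (rule bounded_linear.has_vector_derivative[OF bounded_linear_vec_nth])

lemma mat22_nth [simp]:
  "mat22 a b c d $ 1 $ 1 = a" "mat22 a b c d $ 1 $ 2 = b" "mat22 a b c d $ 2 $ 1 = c" "mat22 a b c d $ 2 $ 2 = d"
  by (simp_all add: mat22_def)

lemma matrix22_eqI:
  fixes A B :: "'a^2^2"
  assumes "A$1$1 = B$1$1" "A$1$2 = B$1$2" "A$2$1 = B$2$1" "A$2$2 = B$2$2"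
  shows "A = B"
  using assms by (simp add: vec_eq_iff forall_2)

lemma matrix_mult_nth2 [simp]:
  fixes A B :: "'a::semiring_1^2^2"
  shows "(A ** B) $ i $ j = A$i$1 * B$1$j + A$i$2 * B$2$j"
  by (simp add: matrix_matrix_mult_def sum_2)

lemma matrix_vector_mult_nth2 [simp]:
  fixes A :: "'a::semiring_1^2^2"
  shows "(A *v x) $ i = A$i$1 * x$1 + A$i$2 * x$2"
  by (simp add: matrix_vector_mult_def sum_2)

lemma axis_nth2 [simp]: "(axis 1 a :: 'a::zero^2) $ 2 = 0" "(axis 2 a :: 'a::zero^2) $ 1 = 0"
  by (simp_all add: axis_def)

lemma axis_nth_same [simp]: "axis i a $ i = a" by (simp add: axis_def)

lemma mat_1_nth2 [simp]: "(mat 1 :: 'a::{zero,one}^2^2) $ 1 $ 1 = 1" "(mat 1 :: 'a^2^2) $ 1 $ 2 = 0"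
  "(mat 1 :: 'a^2^2) $ 2 $ 1 = 0" "(mat 1 :: 'a^2^2) $ 2 $ 2 = 1"
  by (simp_all add: mat_def)

lemma has_vector_derivative_matrix_mult_const:
  fixes Y :: "real \<Rightarrow> complex^2^2" and P :: "complex^2^2"
  assumes "(Y has_vector_derivative D) (at z)"
  shows "((\<lambda>z. P ** Y z) has_vector_derivative P ** D) (at z)"
  by (intro has_vector_derivative_vecI, simp only: matrix_mult_nth2)
    (intro has_vector_derivative_add has_vector_derivative_mult_right
       has_vector_derivative_vec_nth[OF has_vector_derivative_vec_nth[OF assms]])

section \<open>Fundamental matrices and recessive solutions\<close>

text \<open>As a function of \<open>z\<close>, the cross product of two solutions is their Wronskian.\<close>
definition cross2 :: "complex^2 \<Rightarrow> complex^2 \<Rightarrow> complex" where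
  "cross2 x y = x$1 * y$2 - x$2 * y$1"

definition solves :: "(real \<Rightarrow> complex^2^2) \<Rightarrow> (real \<Rightarrow> complex^2) \<Rightarrow> bool" where
  "solves M y \<longleftrightarrow> (\<forall>z\<in>{0<..<1}. (y has_vector_derivative M z *v y z) (at z))"

lemma solves_column:
  fixes Y :: "real \<Rightarrow> complex^2^2" and v :: "complex^2"
  assumes "\<And>z. z \<in> {0<..<1} \<Longrightarrow> (Y has_vector_derivative M z ** Y z) (at z)"
  shows "solves M (\<lambda>z. Y z *v v)"
  unfolding solves_def
proof
  fix z :: real assume "z \<in> {0<..<1}"
  note d = has_vector_derivative_vec_nth[OF has_vector_derivative_vec_nth[OF assms[OF this]]]
  show "((\<lambda>z. Y z *v v) has_vector_derivative M z *v (Y z *v v)) (at z)"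
  proof (rule has_vector_derivative_vecI)
    fix i
    have "((\<lambda>z. (Y z *v v) $ i) has_vector_derivative
        (M z ** Y z) $ i $ 1 * v $ 1 + (M z ** Y z) $ i $ 2 * v $ 2) (at z)"
      unfolding matrix_vector_mult_nth2
      by (intro has_vector_derivative_add has_vector_derivative_mult_left d)
    thus "((\<lambda>z. (Y z *v v) $ i) has_vector_derivative (M z *v (Y z *v v)) $ i) (at z)"
      by (rule has_vector_derivative_eq_rhs) (simp add: algebra_simps)
  qed
qed

lemma cross2_columns: "cross2 (Y *v axis 1 1) (Y *v axis 2 1) = det Y"
  by (simp add: cross2_def det_2 mult.commute)

text \<open>Liouville's formula for a traceless coefficient matrix.\<close>
lemma cross2_solutions_constant:
  assumes "solves M x" "solves M y" and tr: "\<And>z. z \<in> {0<..<1} \<Longrightarrow> trace (M z) = 0"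
  obtains c where "\<And>z. z \<in> {0<..<1} \<Longrightarrow> cross2 (x z) (y z) = c"
proof (rule has_vector_derivative_zero_constant[of "{0<..<1}" "\<lambda>z. cross2 (x z) (y z)"])
  fix z :: real assume z: "z \<in> {0<..<1}"
  have dx: "((\<lambda>z. x z $ i) has_vector_derivative (M z *v x z) $ i) (at z)" for i
    using assms(1) z by (intro has_vector_derivative_vec_nth) (simp add: solves_def)
  have dy: "((\<lambda>z. y z $ i) has_vector_derivative (M z *v y z) $ i) (at z)" for i
    using assms(2) z by (intro has_vector_derivative_vec_nth) (simp add: solves_def)
  have "M z $ 2 $ 2 = - M z $ 1 $ 1" using tr[OF z] by (simp add: trace_def sum_2 eq_neg_iff_add_eq_0 add.commute)
  hence "((\<lambda>z. cross2 (x z) (y z)) has_vector_derivative 0) (at z)"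
    unfolding cross2_def
    by (auto intro!: derivative_eq_intros has_vector_derivative_mult dx dy simp: algebra_simps)
  thus "((\<lambda>z. cross2 (x z) (y z)) has_vector_derivative 0) (at z within {0<..<1})"
    by (rule has_vector_derivative_at_within)
qed (use that in auto)

lemma powA_powQ:
  assumes "s > 0"
  shows "powA \<mu> s ** powQ q s = mat22 (of_real (s powr - alpha \<mu>)) 0
    (q * of_real (ln s) * of_real (s powr alpha \<mu>)) (of_real (s powr alpha \<mu>))"
  by (rule matrix22_eqI) (simp_all add: powA_def powQ_def scaleR_conv_of_real[where 'a = complex])

lemma Y0_column_2: "s > 0 \<Longrightarrow> Y0 \<mu> F q s *v axis 2 1 = of_real (s powr alpha \<mu>) *s (F (of_real s) *v axis 2 1)"
  unfolding Y0_def matrix_mul_assoc[symmetric]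
  by (simp add: powA_powQ vec_eq_iff mult.commute)

lemma det_Y0: "s > 0 \<Longrightarrow> det (Y0 \<mu> F q s) = det (F (of_real s))"
  unfolding Y0_def matrix_mul_assoc[symmetric]
  by (simp add: powA_powQ det_mul) (simp add: det_2 powr_minus flip: of_real_mult)

lemma holomorphic_matrix_tendsto_0:
  assumes "holomorphic_matrix_on F (ball 0 1)"
  shows "((\<lambda>s. F (of_real s) $ i $ j) \<longlongrightarrow> F 0 $ i $ j) (at_right 0)"
proof -
  have "continuous_on (ball 0 1) (\<lambda>z. F z $ i $ j)"
    using assms by (intro holomorphic_on_imp_continuous_on) (simp add: holomorphic_matrix_on_def)
  hence "isCont (\<lambda>z. F z $ i $ j) 0" by (simp add: continuous_on_eq_continuous_at)
  moreover have "((\<lambda>s. complex_of_real s) \<longlongrightarrow> 0) (at_right 0)"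
    using tendsto_of_real[of "\<lambda>x. x" 0 "at_right 0", where 'a = complex] by (simp add: tendsto_ident_at)
  ultimately show ?thesis by (rule isCont_tendsto_compose)
qed

text \<open>The factors \<open>z powr A\<close> and \<open>z powr Q\<close> have determinant \<open>1\<close>, so the constant value of the Wronskian
  is the limit of \<open>det F\<close> at the singular point. In particular invertibility of \<open>F 0\<close> is enough for
  a fundamental matrix.\<close>
lemma det_frobenius:
  assumes "holomorphic_matrix_on F (ball 0 1)"
    and "\<And>z. z \<in> {0<..<1} \<Longrightarrow> (Y0 \<mu> F q has_vector_derivative M z ** Y0 \<mu> F q z) (at z)"
    and "\<And>z. z \<in> {0<..<1} \<Longrightarrow> trace (M z) = 0" and "z \<in> {0<..<1}"
  shows "det (Y0 \<mu> F q z) = det (F 0)"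
proof -
  have ev: "\<forall>\<^sub>F s in at_right 0. (s::real) \<in> {0<..<1}"
    by (rule eventually_at_right_real) simp
  obtain c where c: "\<And>z. z \<in> {0<..<1} \<Longrightarrow> det (Y0 \<mu> F q z) = c"
    using cross2_solutions_constant[OF solves_column[OF assms(2)] solves_column[OF assms(2)] assms(3),
        of "axis 1 1" "axis 2 1"]
    unfolding cross2_columns by blast
  have "((\<lambda>s. det (F (of_real s))) \<longlongrightarrow> det (F 0)) (at_right 0)"
    unfolding det_2 by (intro tendsto_intros holomorphic_matrix_tendsto_0 assms(1))
  moreover have "((\<lambda>s. det (F (of_real s))) \<longlongrightarrow> c) (at_right 0)"
    by (rule tendsto_eventually, rule eventually_mono[OF ev]) (use c det_Y0 in auto)
  ultimately show ?thesis
    using c[OF assms(4)] by (metis tendsto_unique trivial_limit_at_right_real)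
qed

text \<open>The common form of the local data at both singular points; those at \<open>z = 1\<close> arise by the
  reflection \<open>z \<mapsto> 1 - z\<close>.\<close>
definition frobenius_solution where
  "frobenius_solution \<mu> M P F q \<longleftrightarrow> holomorphic_matrix_on F (ball 0 1) \<and> F 0 = P \<and>
     (\<mu> + 1 \<notin> \<int> \<longrightarrow> q = 0) \<and> fundamental_matrix M (Y0 \<mu> F q)"

text \<open>Both second columns are of order \<open>s powr \<alpha>\<close> with \<open>\<alpha> > 0\<close>, so their constant Wronskian is \<open>0\<close> and
  they are proportional; the leading coefficient shows that the factor is \<open>1\<close>.\<close>
lemma recessive_solution_unique:
  assumes sol: "frobenius_solution \<mu> M P F q" "frobenius_solution \<mu> M P F' q'"
    and tr: "\<And>z. z \<in> {0<..<1} \<Longrightarrow> trace (M z) = 0" and mu: "\<mu> \<ge> 0" and P: "P$i$2 \<noteq> 0"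
    and z: "z \<in> {0<..<1}"
  shows "Y0 \<mu> F q z *v axis 2 1 = Y0 \<mu> F' q' z *v axis 2 1"
proof -
  let ?S = "{0<..<1::real}"
  define \<xi> \<eta> \<eta>' where "\<xi> z = Y0 \<mu> F q z *v axis 1 1" and "\<eta> z = Y0 \<mu> F q z *v axis 2 1"
    and "\<eta>' z = Y0 \<mu> F' q' z *v axis 2 1" for z
  have al: "alpha \<mu> > 0" using mu by (simp add: alpha_def)
  have ev: "\<forall>\<^sub>F s in at_right 0. (s::real) \<in> ?S"
    by (rule eventually_at_right_real) simp
  have hol: "holomorphic_matrix_on F (ball 0 1)" "F 0 = P" "holomorphic_matrix_on F' (ball 0 1)" "F' 0 = P"
    using sol by (auto simp: frobenius_solution_def)
  note lim = holomorphic_matrix_tendsto_0[OF hol(1), unfolded hol(2)] holomorphic_matrix_tendsto_0[OF hol(3), unfolded hol(4)]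
  have d: "\<And>z. z \<in> ?S \<Longrightarrow> (Y0 \<mu> F q has_vector_derivative M z ** Y0 \<mu> F q z) (at z)"
    "\<And>z. z \<in> ?S \<Longrightarrow> (Y0 \<mu> F' q' has_vector_derivative M z ** Y0 \<mu> F' q' z) (at z)"
    using sol by (auto simp: frobenius_solution_def fundamental_matrix_def)
  have solves: "solves M \<xi>" "solves M \<eta>" "solves M \<eta>'"
    unfolding \<xi>_def \<eta>_def \<eta>'_def by (intro solves_column d; assumption)+
  obtain a where a: "\<And>z. z \<in> ?S \<Longrightarrow> cross2 (\<xi> z) (\<eta> z) = a"
    using cross2_solutions_constant[OF solves(1,2) tr] by blast
  obtain k where k: "\<And>z. z \<in> ?S \<Longrightarrow> cross2 (\<xi> z) (\<eta>' z) = k"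
    using cross2_solutions_constant[OF solves(1,3) tr] by blast
  obtain c where c: "\<And>z. z \<in> ?S \<Longrightarrow> cross2 (\<eta> z) (\<eta>' z) = c"
    using cross2_solutions_constant[OF solves(2,3) tr] by blast
  have a0: "a \<noteq> 0"
  proof -
    have "invertible (Y0 \<mu> F q z)" using sol(1) z by (simp add: frobenius_solution_def fundamental_matrix_def)
    thus ?thesis using a[OF z] by (simp add: \<xi>_def \<eta>_def cross2_columns invertible_det_nz)
  qed
  have "((\<lambda>s. of_real (s powr alpha \<mu>) * of_real (s powr alpha \<mu>) *
      (F (of_real s) $ 1 $ 2 * F' (of_real s) $ 2 $ 2 - F (of_real s) $ 2 $ 2 * F' (of_real s) $ 1 $ 2)) \<longlongrightarrow>
      of_real (0 powr alpha \<mu>) * of_real (0 powr alpha \<mu>) * (P$1$2 * P$2$2 - P$2$2 * P$1$2)) (at_right 0)"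
    using al by (intro tendsto_intros lim tendsto_powr') (auto simp: eventually_at_filter intro!: always_eventually)
  moreover have "((\<lambda>s. of_real (s powr alpha \<mu>) * of_real (s powr alpha \<mu>) *
      (F (of_real s) $ 1 $ 2 * F' (of_real s) $ 2 $ 2 - F (of_real s) $ 2 $ 2 * F' (of_real s) $ 1 $ 2)) \<longlongrightarrow> c) (at_right 0)"
  proof (rule tendsto_eventually, rule eventually_mono[OF ev])
    fix s assume "s \<in> ?S"
    thus "of_real (s powr alpha \<mu>) * of_real (s powr alpha \<mu>) *
      (F (of_real s) $ 1 $ 2 * F' (of_real s) $ 2 $ 2 - F (of_real s) $ 2 $ 2 * F' (of_real s) $ 1 $ 2) = c"
      using c[of s] by (simp add: \<eta>_def \<eta>'_def cross2_def Y0_column_2 algebra_simps)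
  qed
  ultimately have c0: "c = 0"
    using tendsto_unique[OF trivial_limit_at_right_real] by fastforce
  have proportional: "a * \<eta>' s $ j = k * \<eta> s $ j" if "s \<in> ?S" for s j
  proof -
    have "cross2 (\<xi> s) (\<eta> s) * \<eta>' s $ j - cross2 (\<xi> s) (\<eta>' s) * \<eta> s $ j = - cross2 (\<eta> s) (\<eta>' s) * \<xi> s $ j"
      using exhaust_2[of j] by (auto simp: cross2_def algebra_simps)
    thus ?thesis using a[OF that] k[OF that] c[OF that] c0 by simp
  qed
  have "((\<lambda>s. a * F' (of_real s) $ i $ 2 - k * F (of_real s) $ i $ 2) \<longlongrightarrow> a * P$i$2 - k * P$i$2) (at_right 0)"
    by (intro tendsto_intros lim)
  moreover have "((\<lambda>s. a * F' (of_real s) $ i $ 2 - k * F (of_real s) $ i $ 2) \<longlongrightarrow> 0) (at_right 0)"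
  proof (rule tendsto_eventually, rule eventually_mono[OF ev])
    fix s assume s: "s \<in> ?S"
    hence "of_real (s powr alpha \<mu>) * (a * F' (of_real s) $ i $ 2 - k * F (of_real s) $ i $ 2) = 0"
      using proportional[OF s, of i] by (simp add: \<eta>_def \<eta>'_def Y0_column_2 algebra_simps)
    thus "a * F' (of_real s) $ i $ 2 - k * F (of_real s) $ i $ 2 = 0"
      using s by simp
  qed
  ultimately have "a * P$i$2 - k * P$i$2 = 0"
    using tendsto_unique[OF trivial_limit_at_right_real] by blast
  hence "a = k" using P by simp
  hence "\<eta>' z = \<eta> z" using proportional[OF z] a0 by (simp add: vec_eq_iff)
  thus ?thesis by (simp add: \<eta>_def \<eta>'_def)
qed

text \<open>Conjugation by \<open>P\<close> makes the residue at \<open>0\<close> diagonal, which reduces the claim to the scalar series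
  of \<open>frobenius_columns_exist\<close>.\<close>
lemma frobenius_solution_exists:
  assumes mu: "\<mu> \<ge> 0" and M: "\<And>z. z \<in> {0<..<1} \<Longrightarrow> M z = (1 / z) *\<^sub>R A0 + (1 / (1 - z)) *\<^sub>R A1 + A2"
    and A0: "A0 ** P = P ** mat22 (- of_real (alpha \<mu>)) 0 0 (of_real (alpha \<mu>))" "trace A0 = 0"
    and P: "det P \<noteq> 0" and tr: "trace A1 = 0" "trace A2 = 0"
  obtains F q where "frobenius_solution \<mu> M P F q"
proof -
  define \<alpha> where "\<alpha> = alpha \<mu>"
  have al: "\<alpha> > 0" using mu by (simp add: \<alpha>_def alpha_def)
  have "invertible P" using P by (simp add: invertible_det_nz)
  then obtain Pi where PPi: "P ** Pi = mat 1" unfolding invertible_def by blast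
  define R where "R = Pi ** A1 ** P"
  define S where "S = Pi ** A2 ** P"
  obtain q N f1 f2 g1 g2 where qN: "q \<noteq> 0 \<Longrightarrow> real N = 2 * \<alpha>" "N \<ge> 1" and
    init: "f1 0 = 1" "f2 0 = 0" "g1 0 = 0" "g2 0 = 1" and
    g: "frobenius_column (- 2 * of_real \<alpha>) 0 R S (\<lambda>_. 0) (\<lambda>_. 0) g1 g2" and
    f: "frobenius_column 0 (2 * of_real \<alpha>) R S (\<lambda>z. - q * z ^ N * g1 z) (\<lambda>z. - q * z ^ N * g2 z) f1 f2"
    by (rule frobenius_columns_exist[OF al, of R S]) blast
  define F where "F z = P ** mat22 (f1 z) (g1 z) (f2 z) (g2 z)" for z
  define \<eta>1 where "\<eta>1 s = of_real (s powr \<alpha>) * g1 (of_real s)" for s :: real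
  define \<eta>2 where "\<eta>2 s = of_real (s powr \<alpha>) * g2 (of_real s)" for s :: real
  define \<xi>1 where "\<xi>1 s = of_real (s powr - \<alpha>) * f1 (of_real s) + q * of_real (ln s) * \<eta>1 s" for s :: real
  define \<xi>2 where "\<xi>2 s = of_real (s powr - \<alpha>) * f2 (of_real s) + q * of_real (ln s) * \<eta>2 s" for s :: real
  define W where "W s = mat22 (\<xi>1 s) (\<eta>1 s) (\<xi>2 s) (\<eta>2 s)" for s :: real
  define D where "D = mat22 (- of_real \<alpha>) 0 0 (of_real \<alpha>)"
  define L where "L s = (1 / s) *\<^sub>R D + (1 / (1 - s)) *\<^sub>R R + S" for s :: real
  have YW: "Y0 \<mu> F q s = P ** W s" if "s > 0" for s
    unfolding Y0_def F_def matrix_mul_assoc[symmetric] powA_powQ[OF that]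
    by (intro arg_cong2[where f = "(**)"] refl matrix22_eqI)
      (simp_all add: W_def \<xi>1_def \<xi>2_def \<eta>1_def \<eta>2_def \<alpha>_def algebra_simps)
  have dW: "(W has_vector_derivative L s ** W s) (at s)" if s: "s \<in> {0<..<1}" for s
  proof -
    have s': "complex_of_real s \<in> ball 0 1 - {0}" using s by simp
    define b where "b i j = R$i$j / (1 - of_real s) + S$i$j" for i j
    have L: "L s $ i $ j = D$i$j / of_real s + b i j" for i j
      by (simp add: L_def b_def scaleR_conv_of_real[where 'a = complex])
    have dg: "((\<lambda>s. g1 (of_real s)) has_vector_derivative - 2 * of_real \<alpha> / of_real s * g1 (of_real s) + (b 1 1 * g1 (of_real s) + b 1 2 * g2 (of_real s))) (at s)"
      "((\<lambda>s. g2 (of_real s)) has_vector_derivative (b 2 1 * g1 (of_real s) + b 2 2 * g2 (of_real s))) (at s)"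
      using g s' unfolding frobenius_column_def b_def by (auto dest!: bspec[OF _ s'] has_vector_derivative_real_field)
    have df: "((\<lambda>s. f1 (of_real s)) has_vector_derivative (b 1 1 * f1 (of_real s) + b 1 2 * f2 (of_real s)) - q * of_real s ^ N * g1 (of_real s) / of_real s) (at s)"
      "((\<lambda>s. f2 (of_real s)) has_vector_derivative 2 * of_real \<alpha> / of_real s * f2 (of_real s) + (b 2 1 * f1 (of_real s) + b 2 2 * f2 (of_real s)) - q * of_real s ^ N * g2 (of_real s) / of_real s) (at s)"
      using f s' unfolding frobenius_column_def b_def by (auto dest!: bspec[OF _ s'] has_vector_derivative_real_field)
    have dpow: "((\<lambda>s. of_real (s powr a)) has_vector_derivative (of_real a / of_real s * of_real (s powr a) :: complex)) (at s)" for a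
    proof -
      have "((\<lambda>s. s powr a) has_real_derivative a * s powr (a - 1)) (at s)"
        using s by (auto intro: has_real_derivative_powr)
      also have "a * s powr (a - 1) = a / s * s powr a" using s by (simp add: powr_diff)
      finally have "((\<lambda>s. s powr a) has_real_derivative a / s * s powr a) (at s)" .
      from has_vector_derivative_of_real[OF this, where 'a = complex] show ?thesis by simp
    qed
    have dln: "((\<lambda>s. of_real (ln s)) has_vector_derivative (1 / of_real s :: complex)) (at s)"
    proof -
      have "(ln has_real_derivative 1 / s) (at s)" using s by (auto intro!: derivative_eq_intros)
      from has_vector_derivative_of_real[OF this, where 'a = complex] show ?thesis by simp
    qed
    have e1: "(\<eta>1 has_vector_derivative (- of_real \<alpha> / of_real s * \<eta>1 s + (b 1 1 * \<eta>1 s + b 1 2 * \<eta>2 s))) (at s)"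
      unfolding \<eta>1_def
      by (rule has_vector_derivative_eq_rhs[OF has_vector_derivative_mult[OF dpow dg(1)]])
        (simp add: \<eta>2_def algebra_simps)
    have e2: "(\<eta>2 has_vector_derivative (of_real \<alpha> / of_real s * \<eta>2 s + (b 2 1 * \<eta>1 s + b 2 2 * \<eta>2 s))) (at s)"
      unfolding \<eta>2_def
      by (rule has_vector_derivative_eq_rhs[OF has_vector_derivative_mult[OF dpow dg(2)]])
        (simp add: \<eta>1_def algebra_simps)
    \<comment> \<open>Either \<open>q = 0\<close> or \<open>s\<^sup>N = s powr (2 \<alpha>)\<close>: this lets the logarithmic terms of the first column cancel.\<close>
    have res: "of_real (s powr - \<alpha>) * (q * of_real s ^ N * w) = q * (of_real (s powr \<alpha>) * w)" for w
    proof (cases "q = 0")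
      case False
      have "s ^ N = s powr (2 * \<alpha>)" using qN(1)[OF False] s by (simp add: powr_realpow flip: qN(1)[OF False])
      hence "s powr - \<alpha> * s ^ N = s powr \<alpha>" by (simp flip: powr_add)
      hence "complex_of_real (s powr - \<alpha>) * of_real s ^ N = of_real (s powr \<alpha>)"
        by (metis of_real_mult of_real_power)
      thus ?thesis by (metis (no_types, lifting) mult.assoc mult.left_commute)
    qed simp
    have x1: "(\<xi>1 has_vector_derivative (- of_real \<alpha> / of_real s * \<xi>1 s + (b 1 1 * \<xi>1 s + b 1 2 * \<xi>2 s))) (at s)"
    proof -
      have "(\<xi>1 has_vector_derivative
         (of_real (s powr - \<alpha>) * ((b 1 1 * f1 (of_real s) + b 1 2 * f2 (of_real s)) - q * of_real s ^ N * g1 (of_real s) / of_real s)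
           + of_real (- \<alpha>) / of_real s * of_real (s powr - \<alpha>) * f1 (of_real s))
          + ((q * of_real (ln s)) * (- of_real \<alpha> / of_real s * \<eta>1 s + (b 1 1 * \<eta>1 s + b 1 2 * \<eta>2 s))
            + (q * (1 / of_real s)) * \<eta>1 s)) (at s)"
        unfolding \<xi>1_def
        by (intro has_vector_derivative_add has_vector_derivative_mult dpow df e1 has_vector_derivative_mult_right dln)
      moreover have "of_real (s powr - \<alpha>) * (q * of_real s ^ N * g1 (of_real s)) / of_real s = q * \<eta>1 s / of_real s"
        by (simp only: res \<eta>1_def)
      ultimately show ?thesis
        by (elim has_vector_derivative_eq_rhs) (auto simp: \<xi>1_def \<xi>2_def algebra_simps)
    qed
    have x2: "(\<xi>2 has_vector_derivative (of_real \<alpha> / of_real s * \<xi>2 s + (b 2 1 * \<xi>1 s + b 2 2 * \<xi>2 s))) (at s)"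
    proof -
      have "(\<xi>2 has_vector_derivative
         (of_real (s powr - \<alpha>) * (2 * of_real \<alpha> / of_real s * f2 (of_real s) + (b 2 1 * f1 (of_real s) + b 2 2 * f2 (of_real s)) - q * of_real s ^ N * g2 (of_real s) / of_real s)
           + of_real (- \<alpha>) / of_real s * of_real (s powr - \<alpha>) * f2 (of_real s))
          + ((q * of_real (ln s)) * (of_real \<alpha> / of_real s * \<eta>2 s + (b 2 1 * \<eta>1 s + b 2 2 * \<eta>2 s))
            + (q * (1 / of_real s)) * \<eta>2 s)) (at s)"
        unfolding \<xi>2_def
        by (intro has_vector_derivative_add has_vector_derivative_mult dpow df e2 has_vector_derivative_mult_right dln)
      moreover have "of_real (s powr - \<alpha>) * (q * of_real s ^ N * g2 (of_real s)) / of_real s = q * \<eta>2 s / of_real s"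
        by (simp only: res \<eta>2_def)
      ultimately show ?thesis
        by (elim has_vector_derivative_eq_rhs) (auto simp: \<xi>1_def \<xi>2_def algebra_simps)
    qed
    have "\<forall>i j. ((\<lambda>s. W s $ i $ j) has_vector_derivative (L s ** W s) $ i $ j) (at s)"
      unfolding forall_2 using e1 e2 x1 x2 by (simp add: W_def L D_def algebra_simps)
    thus ?thesis by (intro has_vector_derivative_vecI) simp_all
  qed
  have dY: "(Y0 \<mu> F q has_vector_derivative M s ** Y0 \<mu> F q s) (at s)" if s: "s \<in> {0<..<1}" for s
  proof -
    have "P ** (L s ** W s) = M s ** (P ** W s)"
    proof -
      have P1: "P ** R = A1 ** P" "P ** S = A2 ** P"
        by (simp_all add: R_def S_def matrix_mul_assoc PPi)
      have "P ** L s = (1 / s) *\<^sub>R (P ** D) + (1 / (1 - s)) *\<^sub>R (P ** R) + P ** S"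
        unfolding L_def by (rule matrix22_eqI) (simp_all add: scaleR_conv_of_real[where 'a = complex] algebra_simps)
      also have "\<dots> = (1 / s) *\<^sub>R (A0 ** P) + (1 / (1 - s)) *\<^sub>R (A1 ** P) + A2 ** P"
        by (simp only: P1 A0(1) D_def \<alpha>_def)
      also have "\<dots> = M s ** P"
        unfolding M[OF s] by (rule matrix22_eqI) (simp_all add: scaleR_conv_of_real[where 'a = complex] algebra_simps)
      finally show ?thesis by (simp add: matrix_mul_assoc)
    qed
    moreover have "((\<lambda>s. P ** W s) has_vector_derivative P ** (L s ** W s)) (at s)"
      by (rule has_vector_derivative_matrix_mult_const[OF dW[OF s]])
    ultimately have "((\<lambda>s. P ** W s) has_vector_derivative M s ** Y0 \<mu> F q s) (at s)"
      using YW s by simp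
    thus ?thesis
      by (rule has_vector_derivative_transform_within_open[of _ _ _ "{0<..<1}"]) (use s YW in auto)
  qed
  have hol: "holomorphic_matrix_on F (ball 0 1)"
    using f g unfolding holomorphic_matrix_on_def frobenius_column_def F_def
    by (auto simp: forall_2 intro!: holomorphic_intros)
  have F0: "F 0 = P"
    unfolding F_def by (rule matrix22_eqI) (simp_all add: init)
  have trM: "trace (M z) = 0" if "z \<in> {0<..<1}" for z
    using tr A0(2) by (simp add: M[OF that] trace_def sum_2 algebra_simps flip: scaleR_add_right)
  have "fundamental_matrix M (Y0 \<mu> F q)"
    unfolding fundamental_matrix_def
    using dY det_frobenius[OF hol dY trM] P F0 by (auto simp: invertible_det_nz)
  moreover have "q = 0" if "\<mu> + 1 \<notin> \<int>"
  proof (rule ccontr)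
    assume "q \<noteq> 0"
    hence "\<mu> + 1 = real N" using qN(1) by (simp add: \<alpha>_def alpha_def)
    thus False using that by (metis Ints_of_nat)
  qed
  ultimately show ?thesis using that[of F q] hol F0 by (auto simp: frobenius_solution_def)
qed

section \<open>The connection coefficient\<close>

lemma holomorphic_matrix_reflect:
  assumes "holomorphic_matrix_on F (ball a 1)"
  shows "holomorphic_matrix_on (\<lambda>z. F (1 - z)) (ball (1 - a) 1)"
  unfolding holomorphic_matrix_on_def
proof (intro allI)
  fix i j
  have "(\<lambda>z. 1 - z) ` ball (1 - a) 1 \<subseteq> ball a 1"
    by (auto simp: dist_norm norm_minus_commute algebra_simps)
  moreover have "(\<lambda>z. F z $ i $ j) holomorphic_on ball a 1" using assms by (simp add: holomorphic_matrix_on_def)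
  ultimately have "((\<lambda>z. F z $ i $ j) \<circ> (\<lambda>z. 1 - z)) holomorphic_on ball (1 - a) 1"
    by (intro holomorphic_on_compose_gen[where t = "ball a 1"] holomorphic_intros)
  thus "(\<lambda>z. F (1 - z) $ i $ j) holomorphic_on ball (1 - a) 1" by (simp add: o_def)
qed

text \<open>The reflection \<open>z \<mapsto> 1 - z\<close> exchanges the two singular points, so that everything proved at \<open>0\<close>
  applies at \<open>1\<close> as well.\<close>
lemma fundamental_matrix_reflect:
  assumes "fundamental_matrix M Y"
  shows "fundamental_matrix (\<lambda>s. - M (1 - s)) (\<lambda>s. Y (1 - s))"
  unfolding fundamental_matrix_def
proof (intro ballI conjI)
  fix s :: real assume "s \<in> {0<..<1}"
  hence s: "1 - s \<in> {0<..<1}" by simp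
  have "((\<lambda>s. 1 - s) has_vector_derivative (- 1 :: real)) (at s)"
    by (auto intro!: derivative_eq_intros)
  moreover have "(Y has_vector_derivative M (1 - s) ** Y (1 - s)) (at (1 - s))"
    using assms s unfolding fundamental_matrix_def by blast
  ultimately have "(Y \<circ> (\<lambda>s. 1 - s) has_vector_derivative (- 1) *\<^sub>R (M (1 - s) ** Y (1 - s))) (at s)"
    by (rule vector_diff_chain_at)
  moreover have "(- 1) *\<^sub>R (M (1 - s) ** Y (1 - s)) = - M (1 - s) ** Y (1 - s)"
    by (rule matrix22_eqI) simp_all
  ultimately show "((\<lambda>s. Y (1 - s)) has_vector_derivative - M (1 - s) ** Y (1 - s)) (at s)"
    by (simp add: o_def)
  show "invertible (Y (1 - s))" using assms s unfolding fundamental_matrix_def by blast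
qed

lemma Y1_eq_Y0_reflected: "Y1 \<mu> F q z = Y0 \<mu> (\<lambda>z. F (1 - z)) q (1 - z)"
  by (simp add: Y0_def Y1_def)

lemma local_data_0_iff: 
  "local_data_0 \<mu> \<Lambda> u1 u2 u3 F q \<longleftrightarrow> frobenius_solution \<mu> (system_matrix \<mu> \<Lambda> u1 u2 u3)
     (mat22 1 ((of_real u3 + \<Lambda>) / of_real (2 * alpha \<mu>)) 0 1) F q"
  by (simp add: local_data_0_def frobenius_solution_def)

lemma local_data_1_iff: 
  "local_data_1 \<mu> \<Lambda> u1 u2 u3 F q \<longleftrightarrow> frobenius_solution \<mu> (\<lambda>s. - system_matrix \<mu> \<Lambda> u1 u2 u3 (1 - s))
     (mat22 1 0 (- \<Lambda> / of_real (2 * alpha \<mu>)) 1) (\<lambda>z. F (1 - z)) q"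
proof -
  have 1: "holomorphic_matrix_on F (ball 1 1) \<longleftrightarrow> holomorphic_matrix_on (\<lambda>z. F (1 - z)) (ball 0 1)"
    using holomorphic_matrix_reflect[of F 1] holomorphic_matrix_reflect[of "\<lambda>z. F (1 - z)" 0] by auto
  have 2: "(\<lambda>s. Y1 \<mu> F q (1 - s)) = Y0 \<mu> (\<lambda>z. F (1 - z)) q"
    by (simp add: Y1_eq_Y0_reflected)
  have 3: "(\<lambda>s. Y0 \<mu> (\<lambda>z. F (1 - z)) q (1 - s)) = Y1 \<mu> F q"
    by (rule ext) (simp add: Y1_eq_Y0_reflected)
  have "fundamental_matrix (system_matrix \<mu> \<Lambda> u1 u2 u3) (Y1 \<mu> F q) \<longleftrightarrow>
     fundamental_matrix (\<lambda>s. - system_matrix \<mu> \<Lambda> u1 u2 u3 (1 - s)) (Y0 \<mu> (\<lambda>z. F (1 - z)) q)"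
    using fundamental_matrix_reflect[of "system_matrix \<mu> \<Lambda> u1 u2 u3" "Y1 \<mu> F q"]
      fundamental_matrix_reflect[of "\<lambda>s. - system_matrix \<mu> \<Lambda> u1 u2 u3 (1 - s)" "Y0 \<mu> (\<lambda>z. F (1 - z)) q"]
    unfolding 2 3 by auto
  thus ?thesis using 1 by (simp add: local_data_1_def frobenius_solution_def)
qed

lemma trace_system_matrix: "trace (system_matrix \<mu> \<Lambda> u1 u2 u3 z) = 0"
  by (simp add: system_matrix_def trace_def sum_2 algebra_simps)

lemma trace_uminus: "trace (- A) = - trace (A :: complex^2^2)"
  by (simp add: trace_def sum_2)

lemma local_data_exist:
  assumes "\<mu> \<ge> 0"
  shows "\<exists>F q. local_data_0 \<mu> \<Lambda> u1 u2 u3 F q" "\<exists>F q. local_data_1 \<mu> \<Lambda> u1 u2 u3 F q"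
proof -
  have al: "alpha \<mu> > 0" using assms by (simp add: alpha_def)
  define A0 where "A0 = mat22 (- of_real (alpha \<mu>)) (of_real u3 + \<Lambda>) 0 (of_real (alpha \<mu>))"
  define A1 where "A1 = mat22 (of_real (alpha \<mu>)) 0 (- \<Lambda>) (- of_real (alpha \<mu>))"
  define A2 where "A2 = mat22 (of_real (2 * u2)) (of_real (2 * (u1 + u2^2))) (- 2) (of_real (- 2 * u2))"
  have M: "system_matrix \<mu> \<Lambda> u1 u2 u3 z = (1 / z) *\<^sub>R A0 + (1 / (1 - z)) *\<^sub>R A1 + A2" for z
    by (simp add: system_matrix_def A0_def A1_def A2_def)
  have tr: "trace A0 = 0" "trace A1 = 0" "trace A2 = 0"
    by (simp_all add: A0_def A1_def A2_def trace_def sum_2)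
  obtain F q where "frobenius_solution \<mu> (system_matrix \<mu> \<Lambda> u1 u2 u3)
     (mat22 1 ((of_real u3 + \<Lambda>) / of_real (2 * alpha \<mu>)) 0 1) F q"
  proof (rule frobenius_solution_exists[OF assms(1) M])
    show "A0 ** mat22 1 ((of_real u3 + \<Lambda>) / of_real (2 * alpha \<mu>)) 0 1 =
      mat22 1 ((of_real u3 + \<Lambda>) / of_real (2 * alpha \<mu>)) 0 1 ** mat22 (- of_real (alpha \<mu>)) 0 0 (of_real (alpha \<mu>))"
      using al by (intro matrix22_eqI) (simp_all add: A0_def field_simps)
  qed (use tr in \<open>simp_all add: det_2\<close>)
  thus "\<exists>F q. local_data_0 \<mu> \<Lambda> u1 u2 u3 F q" unfolding local_data_0_iff by blast
  obtain F q where F: "frobenius_solution \<mu> (\<lambda>s. - system_matrix \<mu> \<Lambda> u1 u2 u3 (1 - s))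
     (mat22 1 0 (- \<Lambda> / of_real (2 * alpha \<mu>)) 1) F q"
  proof (rule frobenius_solution_exists[OF assms(1), of _ "- A1" "- A0" "- A2"])
    show "- system_matrix \<mu> \<Lambda> u1 u2 u3 (1 - z) = (1 / z) *\<^sub>R - A1 + (1 / (1 - z)) *\<^sub>R - A0 + - A2" for z
      by (simp add: M)
    show "- A1 ** mat22 1 0 (- \<Lambda> / of_real (2 * alpha \<mu>)) 1 =
      mat22 1 0 (- \<Lambda> / of_real (2 * alpha \<mu>)) 1 ** mat22 (- of_real (alpha \<mu>)) 0 0 (of_real (alpha \<mu>))"
      using al by (intro matrix22_eqI) (simp_all add: A1_def field_simps)
  qed (use tr in \<open>simp_all add: det_2 trace_uminus\<close>)
  have "local_data_1 \<mu> \<Lambda> u1 u2 u3 (\<lambda>z. F (1 - z)) q"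
    using F by (simp add: local_data_1_iff)
  thus "\<exists>F q. local_data_1 \<mu> \<Lambda> u1 u2 u3 F q" by blast
qed

lemma local_data_unique:
  assumes "\<mu> \<ge> 0" "z \<in> {0<..<1}"
  shows "local_data_0 \<mu> \<Lambda> u1 u2 u3 F q \<Longrightarrow> local_data_0 \<mu> \<Lambda> u1 u2 u3 F' q' \<Longrightarrow>
      Y0 \<mu> F q z *v axis 2 1 = Y0 \<mu> F' q' z *v axis 2 1"
    and "local_data_1 \<mu> \<Lambda> u1 u2 u3 F q \<Longrightarrow> local_data_1 \<mu> \<Lambda> u1 u2 u3 F' q' \<Longrightarrow>
      Y1 \<mu> F q z *v axis 2 1 = Y1 \<mu> F' q' z *v axis 2 1"
proof -
  show "Y0 \<mu> F q z *v axis 2 1 = Y0 \<mu> F' q' z *v axis 2 1"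
    if "local_data_0 \<mu> \<Lambda> u1 u2 u3 F q" "local_data_0 \<mu> \<Lambda> u1 u2 u3 F' q'"
    by (rule recessive_solution_unique[OF that[unfolded local_data_0_iff] trace_system_matrix assms(1) _ assms(2), of 2]) simp
  show "Y1 \<mu> F q z *v axis 2 1 = Y1 \<mu> F' q' z *v axis 2 1"
    if "local_data_1 \<mu> \<Lambda> u1 u2 u3 F q" "local_data_1 \<mu> \<Lambda> u1 u2 u3 F' q'"
    unfolding Y1_eq_Y0_reflected
    by (rule recessive_solution_unique[OF that[unfolded local_data_1_iff] _ assms(1), of 2])
      (use assms(2) in \<open>simp_all add: trace_uminus trace_system_matrix\<close>)
qed

lemma det_local_data_1:
  assumes "local_data_1 \<mu> \<Lambda> u1 u2 u3 F q" "z \<in> {0<..<1}"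
  shows "det (Y1 \<mu> F q z) = 1"
proof -
  have F: "frobenius_solution \<mu> (\<lambda>s. - system_matrix \<mu> \<Lambda> u1 u2 u3 (1 - s))
     (mat22 1 0 (- \<Lambda> / of_real (2 * alpha \<mu>)) 1) (\<lambda>z. F (1 - z)) q"
    using assms(1) by (simp add: local_data_1_iff)
  have "det (Y0 \<mu> (\<lambda>z. F (1 - z)) q (1 - z)) = det (F (1 - 0))"
    by (rule det_frobenius[where M = "\<lambda>s. - system_matrix \<mu> \<Lambda> u1 u2 u3 (1 - s)"])
      (use F assms(2) in \<open>auto simp: frobenius_solution_def fundamental_matrix_def trace_uminus trace_system_matrix\<close>)
  also have "\<dots> = 1" using F by (simp add: frobenius_solution_def det_2)
  finally show ?thesis by (simp add: Y1_eq_Y0_reflected)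
qed

lemma solves_local_data:
  "local_data_0 \<mu> \<Lambda> u1 u2 u3 F q \<Longrightarrow> solves (system_matrix \<mu> \<Lambda> u1 u2 u3) (\<lambda>z. Y0 \<mu> F q z *v v)"
  "local_data_1 \<mu> \<Lambda> u1 u2 u3 F q \<Longrightarrow> solves (system_matrix \<mu> \<Lambda> u1 u2 u3) (\<lambda>z. Y1 \<mu> F q z *v v)"
  by (rule solves_column, simp add: local_data_0_def local_data_1_def fundamental_matrix_def)+

text \<open>Cramer's rule in the plane.\<close>
lemma cross2_cramer: "cross2 y w *s x = cross2 x w *s y + cross2 y x *s w"
  by (simp add: vec_eq_iff forall_2 cross2_def algebra_simps)

text \<open>Both connection coefficients are Wronskians, because \<open>Y\<^sub>1\<close> has determinant \<open>1\<close>.\<close>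
lemma connection_coefficient_exists:
  assumes "\<mu> \<ge> 0"
  shows "\<exists>\<theta> \<omega>. connection_coefficients \<mu> \<Lambda> u1 u2 u3 \<theta> \<omega>"
proof -
  obtain F0 q0 F1 q1 where d: "local_data_0 \<mu> \<Lambda> u1 u2 u3 F0 q0" "local_data_1 \<mu> \<Lambda> u1 u2 u3 F1 q1"
    using local_data_exist[OF assms] by blast
  let ?\<eta>0 = "\<lambda>z. Y0 \<mu> F0 q0 z *v axis 2 1"
  let ?y1 = "\<lambda>z. Y1 \<mu> F1 q1 z *v axis 1 1"
  let ?\<eta>1 = "\<lambda>z. Y1 \<mu> F1 q1 z *v axis 2 1"
  note const = cross2_solutions_constant[OF _ _ trace_system_matrix]
  obtain \<theta> where \<theta>: "\<And>z. z \<in> {0<..<1} \<Longrightarrow> cross2 (?\<eta>0 z) (?\<eta>1 z) = \<theta>"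
    using const[OF solves_local_data(1)[OF d(1)] solves_local_data(2)[OF d(2)]] by blast
  obtain \<omega> where \<omega>: "\<And>z. z \<in> {0<..<1} \<Longrightarrow> cross2 (?y1 z) (?\<eta>0 z) = \<omega>"
    using const[OF solves_local_data(2)[OF d(2)] solves_local_data(1)[OF d(1)]] by blast
  have "?\<eta>0 z = \<theta> *s ?y1 z + \<omega> *s ?\<eta>1 z" if "z \<in> {0<..<1}" for z
    using cross2_cramer[of "?y1 z" "?\<eta>1 z" "?\<eta>0 z"] \<theta>[OF that] \<omega>[OF that] det_local_data_1[OF d(2) that]
    by (simp add: cross2_columns)
  thus ?thesis using d unfolding connection_coefficients_def by blast
qed

text \<open>The local data need not be unique, but \<open>\<theta>\<close> is the Wronskian of the two recessive solutions, and
  these are.\<close>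
lemma connection_coefficient_unique:
  assumes "\<mu> \<ge> 0" "connection_coefficients \<mu> \<Lambda> u1 u2 u3 \<theta> \<omega>" "connection_coefficients \<mu> \<Lambda> u1 u2 u3 \<theta>' \<omega>'"
  shows "\<theta> = \<theta>'"
proof -
  have half: "(1/2::real) \<in> {0<..<1}" by simp
  have wronskian: "\<theta> = cross2 (Y0 \<mu> F0 q0 (1/2) *v axis 2 1) (Y1 \<mu> F1 q1 (1/2) *v axis 2 1)"
    if "local_data_1 \<mu> \<Lambda> u1 u2 u3 F1 q1"
      "\<forall>z\<in>{0<..<1}. Y0 \<mu> F0 q0 z *v axis 2 1 = \<theta> *s (Y1 \<mu> F1 q1 z *v axis 1 1) + \<omega> *s (Y1 \<mu> F1 q1 z *v axis 2 1)"
    for \<theta> \<omega> F0 q0 F1 q1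
  proof -
    have "cross2 (\<theta> *s a + \<omega> *s b) b = \<theta> * cross2 a b" for a b
      by (simp add: cross2_def algebra_simps)
    thus ?thesis
      unfolding bspec[OF that(2) half] by (simp only: cross2_columns det_local_data_1[OF that(1) half] mult_1_right)
  qed
  obtain F0 q0 F1 q1 where d: "local_data_0 \<mu> \<Lambda> u1 u2 u3 F0 q0" "local_data_1 \<mu> \<Lambda> u1 u2 u3 F1 q1" and
    \<theta>: "\<theta> = cross2 (Y0 \<mu> F0 q0 (1/2) *v axis 2 1) (Y1 \<mu> F1 q1 (1/2) *v axis 2 1)"
    using assms(2) wronskian unfolding connection_coefficients_def by blast
  obtain F0' q0' F1' q1' where d': "local_data_0 \<mu> \<Lambda> u1 u2 u3 F0' q0'" "local_data_1 \<mu> \<Lambda> u1 u2 u3 F1' q1'" and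
    \<theta>': "\<theta>' = cross2 (Y0 \<mu> F0' q0' (1/2) *v axis 2 1) (Y1 \<mu> F1' q1' (1/2) *v axis 2 1)"
    using assms(3) wronskian unfolding connection_coefficients_def by blast
  show ?thesis
    unfolding \<theta> \<theta>' local_data_unique(1)[OF assms(1) half d(1) d'(1)] local_data_unique(2)[OF assms(1) half d(2) d'(2)] ..
qed

text \<open>Unique existence turns the definite description into a usable equation: the dominant solution at
  \<open>1\<close> does not contribute to the recessive solution at \<open>0\<close>.\<close>
lemma recessive_solutions_match:
  assumes "\<mu> \<ge> 0" "Theta \<mu> \<Lambda> u1 u2 u3 = 0"
  obtains F0 q0 F1 q1 \<omega> where "local_data_0 \<mu> \<Lambda> u1 u2 u3 F0 q0" "local_data_1 \<mu> \<Lambda> u1 u2 u3 F1 q1"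
    "\<And>z. z \<in> {0<..<1} \<Longrightarrow> Y0 \<mu> F0 q0 z *v axis 2 1 = \<omega> *s (Y1 \<mu> F1 q1 z *v axis 2 1)"
proof -
  have "\<exists>!\<theta>. \<exists>\<omega>. connection_coefficients \<mu> \<Lambda> u1 u2 u3 \<theta> \<omega>"
    using connection_coefficient_exists[OF assms(1)] connection_coefficient_unique[OF assms(1)] by blast
  from theI'[OF this] obtain \<omega> where "connection_coefficients \<mu> \<Lambda> u1 u2 u3 0 \<omega>"
    using assms(2) unfolding Theta_def by auto
  then obtain F0 q0 F1 q1 where "local_data_0 \<mu> \<Lambda> u1 u2 u3 F0 q0" "local_data_1 \<mu> \<Lambda> u1 u2 u3 F1 q1"
    "\<forall>z\<in>{0<..<1}. Y0 \<mu> F0 q0 z *v axis 2 1 = \<omega> *s (Y1 \<mu> F1 q1 z *v axis 2 1)"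
    unfolding connection_coefficients_def by auto
  thus ?thesis by (intro that) auto
qed

lemma recessive_column_bound:
  assumes "holomorphic_matrix_on F (ball 0 1)"
  obtains C where "C \<ge> 0" "\<And>s. s \<in> {0<..1/2} \<Longrightarrow> norm (Y0 \<mu> F q s *v axis 2 1) \<le> C * s powr alpha \<mu>"
proof -
  have cont: "continuous_on {0..1/2} (\<lambda>s. F (of_real s) $ i $ 2)" for i
  proof (rule continuous_on_compose2[of "ball 0 1" "\<lambda>z. F z $ i $ 2"])
    show "continuous_on (ball 0 1) (\<lambda>z. F z $ i $ 2)"
      using assms by (intro holomorphic_on_imp_continuous_on) (simp add: holomorphic_matrix_on_def)
  qed (auto intro!: continuous_intros)
  have "bounded ((\<lambda>s. norm (F (of_real s) $ 1 $ 2) + norm (F (of_real s) $ 2 $ 2)) ` {0..1/2})"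
    by (intro compact_imp_bounded compact_continuous_image continuous_on_add continuous_on_norm cont) auto
  then obtain C where "\<forall>s\<in>{0..1/2}. norm (F (of_real s) $ 1 $ 2) + norm (F (of_real s) $ 2 $ 2) \<le> C"
    by (auto simp: bounded_iff)
  hence C: "norm (F (of_real s) $ 1 $ 2) + norm (F (of_real s) $ 2 $ 2) \<le> C" if "s \<in> {0..1/2}" for s
    using that by blast
  have "C \<ge> 0" by (rule order_trans[OF _ C[of 0]]) (simp_all add: add_nonneg_nonneg)
  moreover have "norm (Y0 \<mu> F q s *v axis 2 1) \<le> C * s powr alpha \<mu>" if s: "s \<in> {0<..1/2}" for s
  proof -
    have "norm (Y0 \<mu> F q s *v axis 2 1) \<le> (\<Sum>i\<in>UNIV. norm ((Y0 \<mu> F q s *v axis 2 1) $ i))"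
      unfolding norm_vec_def by (rule L2_set_le_sum) simp
    also have "\<dots> = s powr alpha \<mu> * (norm (F (of_real s) $ 1 $ 2) + norm (F (of_real s) $ 2 $ 2))"
      using s by (simp add: Y0_column_2 sum_2 norm_mult algebra_simps)
    also have "\<dots> \<le> s powr alpha \<mu> * C" using s by (intro mult_left_mono C) auto
    finally show ?thesis by (simp add: mult.commute)
  qed
  ultimately show ?thesis by (rule that)
qed

text \<open>On \<open>{0<..1/2}\<close> the decay comes from the expansion at \<open>0\<close>, on the other half from the expansion
  at \<open>1\<close>; the remaining factor of \<open>z (1 - z)\<close> is at least \<open>1/2\<close>, whence the constant
  \<open>2 powr \<alpha>\<close>.\<close>
lemma Theta_zero_imp_decaying_solution:
  assumes "\<mu> \<ge> 0" "Theta \<mu> \<Lambda> u1 u2 u3 = 0"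
  obtains \<eta> C where "solves (system_matrix \<mu> \<Lambda> u1 u2 u3) \<eta>" "\<And>z. z \<in> {0<..<1} \<Longrightarrow> \<eta> z \<noteq> 0"
    "\<And>z. z \<in> {0<..<1} \<Longrightarrow> norm (\<eta> z) \<le> C * (z * (1 - z)) powr alpha \<mu>"
proof -
  obtain F0 q0 F1 q1 \<omega> where d: "local_data_0 \<mu> \<Lambda> u1 u2 u3 F0 q0" "local_data_1 \<mu> \<Lambda> u1 u2 u3 F1 q1" and
    eq: "\<And>z. z \<in> {0<..<1} \<Longrightarrow> Y0 \<mu> F0 q0 z *v axis 2 1 = \<omega> *s (Y1 \<mu> F1 q1 z *v axis 2 1)"
    using recessive_solutions_match[OF assms] by blast
  define \<eta> where "\<eta> z = Y0 \<mu> F0 q0 z *v axis 2 1" for z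
  have al: "alpha \<mu> \<ge> 0" using assms by (simp add: alpha_def)
  have nz: "\<eta> z \<noteq> 0" if "z \<in> {0<..<1}" for z
  proof
    assume "\<eta> z = 0"
    hence "det (Y0 \<mu> F0 q0 z) = 0" unfolding cross2_columns[symmetric] \<eta>_def by (simp add: cross2_def)
    moreover have "invertible (Y0 \<mu> F0 q0 z)" using d(1) that by (simp add: local_data_0_def fundamental_matrix_def)
    ultimately show False by (simp add: invertible_det_nz)
  qed
  have hol: "holomorphic_matrix_on F0 (ball 0 1)" "holomorphic_matrix_on (\<lambda>z. F1 (1 - z)) (ball 0 1)"
    using d by (simp_all add: local_data_0_iff local_data_1_iff frobenius_solution_def)
  obtain C0 where C0: "C0 \<ge> 0" "\<And>s. s \<in> {0<..1/2} \<Longrightarrow> norm (Y0 \<mu> F0 q0 s *v axis 2 1) \<le> C0 * s powr alpha \<mu>"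
    using recessive_column_bound[OF hol(1), of \<mu> q0] by blast
  obtain C1 where C1: "C1 \<ge> 0" "\<And>s. s \<in> {0<..1/2} \<Longrightarrow> norm (Y0 \<mu> (\<lambda>z. F1 (1 - z)) q1 s *v axis 2 1) \<le> C1 * s powr alpha \<mu>"
    using recessive_column_bound[OF hol(2), of \<mu> q1] by blast
  define C where "C = max C0 (norm \<omega> * C1) * 2 powr alpha \<mu>"
  have half: "s powr alpha \<mu> \<le> 2 powr alpha \<mu> * (s * (1 - s)) powr alpha \<mu>" if "s \<in> {0<..1/2}" for s
  proof -
    have "s * 1 \<le> s * (2 * (1 - s))" using that by (intro mult_left_mono) auto
    hence "s powr alpha \<mu> \<le> (2 * (s * (1 - s))) powr alpha \<mu>" using that al by (intro powr_mono2) auto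
    thus ?thesis using that by (simp add: powr_mult)
  qed
  have decay: "norm (\<eta> z) \<le> C * (z * (1 - z)) powr alpha \<mu>" if z: "z \<in> {0<..<1}" for z
  proof (cases "z \<le> 1/2")
    case True
    hence "norm (\<eta> z) \<le> C0 * z powr alpha \<mu>" using C0(2)[of z] z by (simp add: \<eta>_def)
    also have "\<dots> \<le> max C0 (norm \<omega> * C1) * (2 powr alpha \<mu> * (z * (1 - z)) powr alpha \<mu>)"
      using C0 True z by (intro mult_mono half) (auto simp: le_max_iff_disj)
    finally show ?thesis by (simp add: C_def mult.assoc)
  next
    case False
    hence z': "1 - z \<in> {0<..1/2}" using z by simp
    have "\<eta> z = \<omega> *s (Y0 \<mu> (\<lambda>z. F1 (1 - z)) q1 (1 - z) *v axis 2 1)"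
      using eq[OF z] by (simp add: \<eta>_def Y1_eq_Y0_reflected)
    hence "norm (\<eta> z) = norm \<omega> * norm (Y0 \<mu> (\<lambda>z. F1 (1 - z)) q1 (1 - z) *v axis 2 1)"
      by (simp add: norm_vec_def L2_set_def norm_mult power_mult_distrib sum_2 real_sqrt_mult flip: distrib_left)
    also have "\<dots> \<le> norm \<omega> * (C1 * (1 - z) powr alpha \<mu>)"
      by (intro mult_left_mono C1 z') auto
    also have "\<dots> = (norm \<omega> * C1) * (1 - z) powr alpha \<mu>" by simp
    also have "\<dots> \<le> max C0 (norm \<omega> * C1) * (2 powr alpha \<mu> * ((1 - z) * (1 - (1 - z))) powr alpha \<mu>)"
      using C0 z' by (intro mult_mono half) (auto simp: le_max_iff_disj)
    finally show ?thesis by (simp add: C_def mult.assoc mult.commute[of z])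
  qed
  have "solves (system_matrix \<mu> \<Lambda> u1 u2 u3) \<eta>"
    unfolding \<eta>_def by (rule solves_local_data(1)[OF d(1)])
  thus ?thesis using nz decay by (rule that)
qed

section \<open>Isomonodromic deformation\<close>

lemma bounded_bilinear_matrix_vector: "bounded_bilinear ((*v) :: complex^2^2 \<Rightarrow> complex^2 \<Rightarrow> complex^2)"
  unfolding bilinear_conv_bounded_bilinear[symmetric] bilinear_def
  by (auto intro!: linearI simp: vec_eq_iff forall_2 algebra_simps)

text \<open>For fixed \<open>z\<close> the solution \<open>\<eta> z\<close> is transported along \<open>\<partial>\<^sub>s y = N y\<close>, where \<open>N = A + z C\<close>. By the
  zero curvature equation \<open>V = M y\<close> satisfies the equation that \<open>\<partial>\<^sub>z y\<close> has to satisfy, and it has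
  the same initial value; so \<open>\<partial>\<^sub>z y = M y\<close> at every time. The bounds in both directions hold since \<open>N\<close> is
  bounded uniformly in \<open>z\<close>, in contrast to \<open>M\<close>, which is singular at \<open>0\<close> and \<open>1\<close>.\<close>
lemma isomonodromic_transport:
  fixes M :: "real \<Rightarrow> real \<Rightarrow> complex^2^2" and A C :: "real \<Rightarrow> complex^2^2"
  assumes cont: "continuous_on {0..1} A" "continuous_on {0..1} C"
    and flat: "\<And>s z. s \<in> {0..1} \<Longrightarrow> z \<in> {0<..<1} \<Longrightarrow>
      ((\<lambda>s. M s z) has_vector_derivative
         C s + (A s + z *\<^sub>R C s) ** M s z - M s z ** (A s + z *\<^sub>R C s)) (at s within {0..1})"
    and \<eta>: "solves (M 0) \<eta>"
  obtains \<zeta> E where "solves (M 1) \<zeta>" "E \<ge> 0"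
    "\<And>z. z \<in> {0<..<1} \<Longrightarrow> norm (\<zeta> z) \<le> E * norm (\<eta> z)"
    "\<And>z. z \<in> {0<..<1} \<Longrightarrow> norm (\<eta> z) \<le> E * norm (\<zeta> z)"
proof -
  interpret mv: bounded_bilinear "(*v) :: complex^2^2 \<Rightarrow> complex^2 \<Rightarrow> complex^2"
    by (rule bounded_bilinear_matrix_vector)
  obtain k where k: "k > 0" "\<And>(B::complex^2^2) x. norm (B *v x) \<le> norm B * norm x * k"
    using mv.pos_bounded by blast
  have "bounded (A ` {0..1})" by (intro compact_imp_bounded compact_continuous_image cont compact_Icc)
  then obtain a where a: "\<And>s. s \<in> {0..1} \<Longrightarrow> norm (A s) \<le> a" unfolding bounded_iff by blast
  have "bounded (C ` {0..1})" by (intro compact_imp_bounded compact_continuous_image cont compact_Icc)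
  then obtain c where c: "\<And>s. s \<in> {0..1} \<Longrightarrow> norm (C s) \<le> c" unfolding bounded_iff by blast
  have ac0: "a \<ge> 0" "c \<ge> 0" using order_trans[OF norm_ge_zero a[of 0]] order_trans[OF norm_ge_zero c[of 0]] by simp_all
  define K where "K = (a + c) * k"
  have K0: "K \<ge> 0" using ac0 k by (simp add: K_def)
  have bound: "norm (B *v x) \<le> K * norm x" if "norm B \<le> a + c" for B :: "complex^2^2" and x
  proof -
    have "norm (B *v x) \<le> norm B * norm x * k" by (rule k)
    also have "\<dots> \<le> (a + c) * norm x * k" using that k by (intro mult_right_mono) auto
    finally show ?thesis by (simp add: K_def mult_ac)
  qed
  have boundA: "norm (A s *v x) \<le> K * norm x" and boundC: "norm (C s *v x) \<le> K * norm x"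
    if "s \<in> {0..1}" for s x
    using a[OF that] c[OF that] ac0 by (auto intro!: bound)
  have boundN: "norm ((A s + z *\<^sub>R C s) *v x) \<le> K * norm x" if "s \<in> {0..1}" "z \<in> {0<..<1}" for s z x
  proof (rule bound)
    have "norm (A s + z *\<^sub>R C s) \<le> norm (A s) + \<bar>z\<bar> * norm (C s)" by (metis norm_scaleR norm_triangle_ineq)
    also have "\<dots> \<le> a + 1 * c" using a[OF that(1)] c[OF that(1)] that(2) by (intro add_mono mult_mono) auto
    finally show "norm (A s + z *\<^sub>R C s) \<le> a + c" by simp
  qed
  have "\<exists>y. y 0 = \<eta> z \<and> (\<forall>s\<in>{0..1}. (y has_vector_derivative (A s + z *\<^sub>R C s) *v y s) (at s within {0..1}))"
    if z: "z \<in> {0<..<1}" for z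
  proof (rule lipschitz_ode_solution_exists[of "\<lambda>s x. (A s + z *\<^sub>R C s) *v x" K "\<eta> z"])
    show "continuous_on {0..1} (\<lambda>s. (A s + z *\<^sub>R C s) *v y s)" if "continuous_on {0..1} y" for y
      by (intro mv.continuous_on continuous_intros cont that)
    show "norm ((A s + z *\<^sub>R C s) *v x - (A s + z *\<^sub>R C s) *v y) \<le> K * norm (x - y)" if "s \<in> {0..1}" for s x y
      using boundN[OF that z, of "x - y"] by (simp only: mv.diff_right)
  qed blast
  then obtain y where y0: "\<And>z. z \<in> {0<..<1} \<Longrightarrow> y z 0 = \<eta> z" and
    y: "\<And>z s. z \<in> {0<..<1} \<Longrightarrow> s \<in> {0..1} \<Longrightarrow> (y z has_vector_derivative (A s + z *\<^sub>R C s) *v y z s) (at s within {0..1})"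
    by metis
  define \<zeta> where "\<zeta> z = y z 1" for z
  have commute: "X *v (N *v x) + (B + N ** X - X ** N) *v x = N *v (X *v x) + B *v x"
    for X N B :: "complex^2^2" and x
    by (simp add: vec_eq_iff forall_2 algebra_simps)
  have sol: "solves (M 1) \<zeta>"
    unfolding solves_def \<zeta>_def
  proof
    fix z :: real assume z: "z \<in> {0<..<1}"
    define V where "V s = M s z *v y z s" for s
    show "((\<lambda>z. y z 1) has_vector_derivative M 1 z *v y z 1) (at z)"
      unfolding V_def[symmetric]
    proof (rule parameter_derivative_linear_ode[where Z = "{0<..<1}" and K = K and A = "\<lambda>s x. A s *v x" and C = "\<lambda>s x. C s *v x"])
      show "(y \<zeta> has_vector_derivative A s *v y \<zeta> s + \<zeta> *\<^sub>R (C s *v y \<zeta> s)) (at s within {0..1})"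
        if "\<zeta> \<in> {0<..<1}" "s \<in> {0..1}" for \<zeta> s
        using y[OF that] by (simp only: mv.add_left mv.scaleR_left)
      fix s :: real assume s: "s \<in> {0..1}"
      let ?N = "A s + z *\<^sub>R C s"
      have "(V has_vector_derivative M s z *v (?N *v y z s) + (C s + ?N ** M s z - M s z ** ?N) *v y z s) (at s within {0..1})"
        unfolding V_def by (rule mv.has_vector_derivative[OF flat[OF s z] y[OF z s]])
      also have "M s z *v (?N *v y z s) + (C s + ?N ** M s z - M s z ** ?N) *v y z s = ?N *v V s + C s *v y z s"
        unfolding V_def by (rule commute)
      also have "\<dots> = A s *v V s + z *\<^sub>R (C s *v V s) + C s *v y z s"
        by (simp only: mv.add_left mv.scaleR_left)
      finally show "(V has_vector_derivative A s *v V s + z *\<^sub>R (C s *v V s) + C s *v y z s) (at s within {0..1})" .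
    next
      have "(\<eta> has_vector_derivative M 0 z *v \<eta> z) (at z)" using \<eta> z by (auto simp: solves_def)
      hence "(\<eta> has_vector_derivative V 0) (at z)" using y0[OF z] by (simp add: V_def)
      thus "((\<lambda>z. y z 0) has_vector_derivative V 0) (at z)"
        by (rule has_vector_derivative_transform_within_open[of _ _ _ "{0<..<1}"]) (use z y0 in auto)
    qed (use z boundA boundC in \<open>auto intro!: bounded_linear.linear[OF mv.bounded_linear_right]\<close>)
  qed
  have fwd: "norm (\<zeta> z) \<le> exp (K + 1) * norm (\<eta> z)" if z: "z \<in> {0<..<1}" for z
    using linear_ode_bound[OF y[OF z], of K 0 1] boundN[OF _ z] K0 by (simp add: \<zeta>_def y0[OF z])
  have bwd: "norm (\<eta> z) \<le> exp (K + 1) * norm (\<zeta> z)" if z: "z \<in> {0<..<1}" for z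
  proof -
    have "((\<lambda>s. y z (1 - s)) has_vector_derivative - ((A (1 - s) + z *\<^sub>R C (1 - s)) *v y z (1 - s))) (at s within {0..1})"
      if s: "s \<in> {0..1}" for s
    proof -
      have "((\<lambda>s. 1 - s) has_vector_derivative (- 1 :: real)) (at s within {0..1})"
        by (auto intro!: derivative_eq_intros)
      moreover have "(y z has_vector_derivative (A (1 - s) + z *\<^sub>R C (1 - s)) *v y z (1 - s)) (at (1 - s) within (\<lambda>s. 1 - s) ` {0..1})"
        by (rule has_vector_derivative_within_subset[OF y[OF z]]) (use s in auto)
      ultimately have "(y z \<circ> (\<lambda>s. 1 - s) has_vector_derivative (- 1) *\<^sub>R ((A (1 - s) + z *\<^sub>R C (1 - s)) *v y z (1 - s))) (at s within {0..1})"
        by (rule vector_diff_chain_within)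
      thus ?thesis by (simp add: o_def)
    qed
    from linear_ode_bound[OF this, of K 0 1] show ?thesis
      using boundN[OF _ z] K0 by (simp add: \<zeta>_def y0[OF z])
  qed
  show ?thesis by (rule that[OF sol _ fwd bwd]) auto
qed

lemma continuous_on_mat22:
  assumes "continuous_on S a" "continuous_on S b" "continuous_on S c" "continuous_on S d"
  shows "continuous_on S (\<lambda>x. mat22 (a x) (b x) (c x) (d x))"
proof -
  have "mat22 (a x) (b x) (c x) (d x) = (\<chi> i j. if i = 1 then if j = 1 then a x else b x else if j = 1 then c x else d x)" for x
    by (rule matrix22_eqI) simp_all
  moreover have "continuous_on S (\<lambda>x. if i = 1 then if j = 1 then a x else b x else if j = 1 then c x else d x)" for i j :: 2
    using assms by (cases "i = 1"; cases "j = 1") simp_all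
  ultimately show ?thesis by (simp add: continuous_on_vec_lambda)
qed

text \<open>The matrix \<open>B\<close> in \<open>N = B + z C\<close>. The zero curvature equation requires that the residue at \<open>0\<close> evolves
  by the commutator with \<open>B\<close> and the residue at \<open>1\<close> by the commutator with \<open>B + C\<close>. As the
  residues stay upper and lower triangular, respectively, \<open>B\<close> has to be upper triangular and \<open>B + C\<close>
  lower triangular, which fixes the off-diagonal entries; the equation for \<open>\<Lambda>\<close> fixes the
  diagonal.\<close>
definition deformation_constant :: "real \<Rightarrow> real \<Rightarrow> real \<Rightarrow> real \<Rightarrow> complex^2^2" where
  "deformation_constant \<mu> L u1 u2 = mat22 (of_real (L * u2 - \<mu> - 1/2)) (of_real (- 2 * (u1 + u2\<^sup>2))) 0 (of_real (\<mu> + 1/2 - L * u2))"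

definition infinity_matrix :: "real \<Rightarrow> real \<Rightarrow> complex^2^2" where
  "infinity_matrix u1 u2 = mat22 (of_real (2 * u2)) (of_real (2 * (u1 + u2\<^sup>2))) (- 2) (of_real (- 2 * u2))"

text \<open>The factor \<open>\<tau>\<close> is the speed of a linear reparametrisation of time. Multiplied out, each matrix entry
  is a polynomial identity modulo \<open>z i0 = 1\<close> and \<open>(1 - z) i1 = 1\<close>, where \<open>i0\<close> and \<open>i1\<close> are the
  reciprocals of \<open>z\<close> and \<open>1 - z\<close>.\<close>
lemma zero_curvature:
  fixes U1 U2 L :: "real \<Rightarrow> real"
  assumes U1: "(U1 has_real_derivative \<tau> * (2 * U1 s)) (at s within S)"
    and U2: "(U2 has_real_derivative \<tau> * (2 * (L s + 1) * (U1 s + (U2 s)\<^sup>2) - (2 * \<mu> + 1) * U2 s)) (at s within S)"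
    and L: "(L has_real_derivative \<tau> * ((1 + 2 * \<mu> - 2 * L s * U2 s) * (L s + 2) - 2 * \<mu>)) (at s within S)"
    and z: "z \<in> {0<..<1}"
  defines "M \<equiv> \<lambda>s. system_matrix \<mu> (of_real (L s)) (U1 s) (U2 s) ((U1 s + (U2 s)\<^sup>2 - 1) * L s - 2 * (\<mu> + 1) * U2 s) z"
    and "C \<equiv> \<tau> *\<^sub>R infinity_matrix (U1 s) (U2 s)"
    and "A \<equiv> \<tau> *\<^sub>R deformation_constant \<mu> (L s) (U1 s) (U2 s)"
  shows "(M has_vector_derivative C + (A + z *\<^sub>R C) ** M s - M s ** (A + z *\<^sub>R C)) (at s within S)"
proof -
  define \<alpha> where "\<alpha> = (\<mu> + 1) / 2"
  define i0 where "i0 = 1 / z"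
  define i1 where "i1 = 1 / (1 - z)"
  have i: "z * i0 = 1" "(1 - z) * i1 = 1" and al: "2 * \<alpha> = \<mu> + 1"
    using z by (simp_all add: i0_def i1_def \<alpha>_def)
  define m11 where "m11 s = - \<alpha> * i0 + \<alpha> * i1 + 2 * U2 s" for s
  define m12 where "m12 s = ((U1 s + U2 s * U2 s - 1) * L s - 2 * (\<mu> + 1) * U2 s + L s) * i0 + 2 * (U1 s + U2 s * U2 s)" for s
  define m21 where "m21 s = - L s * i1 - 2" for s
  have M: "M s = mat22 (of_real (m11 s)) (of_real (m12 s)) (of_real (m21 s)) (of_real (- m11 s))" for s
    unfolding M_def system_matrix_def alpha_def \<alpha>_def[symmetric] i0_def[symmetric] i1_def[symmetric]
    by (rule matrix22_eqI) (simp_all add: m11_def m12_def m21_def power2_eq_square scaleR_conv_of_real[where 'a = complex] algebra_simps)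
  define b where "b = L s * U2 s - \<mu> - 1/2"
  define v where "v = U1 s + (U2 s)\<^sup>2"
  define n11 where "n11 = \<tau> * (b + z * (2 * U2 s))"
  define n12 where "n12 = \<tau> * (2 * (z - 1) * v)"
  define n21 where "n21 = \<tau> * (- 2 * z)"
  have N: "A + z *\<^sub>R C = mat22 (of_real n11) (of_real n12) (of_real n21) (of_real (- n11))"
    unfolding A_def C_def deformation_constant_def infinity_matrix_def
    by (rule matrix22_eqI) (simp_all add: n11_def n12_def n21_def b_def v_def scaleR_conv_of_real[where 'a = complex] algebra_simps)
  have C: "C = mat22 (of_real (\<tau> * (2 * U2 s))) (of_real (\<tau> * (2 * v))) (of_real (- 2 * \<tau>)) (of_real (- \<tau> * (2 * U2 s)))"
    unfolding C_def infinity_matrix_def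
    by (rule matrix22_eqI) (simp_all add: v_def scaleR_conv_of_real[where 'a = complex])
  have b2: "2 * b = 2 * (L s * U2 s) - (2 * \<mu> + 1)" by (simp add: b_def)
  note rules = U1 U2 L DERIV_const DERIV_minus DERIV_add DERIV_diff DERIV_cmult DERIV_cmult_right DERIV_mult
  have d11: "(m11 has_real_derivative \<tau> * (2 * U2 s) + n12 * m21 s - m12 s * n21) (at s within S)"
    unfolding m11_def[abs_def]
    by (rule DERIV_cong, (rule rules)+)
      (unfold n12_def n21_def m12_def m21_def v_def, use i in algebra)
  have d21: "(m21 has_real_derivative - 2 * \<tau> + n21 * m11 s - n11 * m21 s - (m21 s * n11 - m11 s * n21)) (at s within S)"
    unfolding m21_def[abs_def]
    by (rule DERIV_cong, (rule rules)+)
      (unfold n11_def n21_def m11_def, use i al b2 in algebra)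
  have d12: "(m12 has_real_derivative \<tau> * (2 * v) + n11 * m12 s - n12 * m11 s - (m11 s * n12 - m12 s * n11)) (at s within S)"
    unfolding m12_def[abs_def]
    by (rule DERIV_cong, (rule rules)+)
      (unfold n11_def n12_def m11_def v_def, use i al b2 in algebra)
  have "\<forall>i j. ((\<lambda>s. M s $ i $ j) has_vector_derivative (C + (A + z *\<^sub>R C) ** M s - M s ** (A + z *\<^sub>R C)) $ i $ j) (at s within S)"
    unfolding forall_2 N unfolding M C
    using has_vector_derivative_of_real[OF d11, where 'a = complex] has_vector_derivative_of_real[OF d12, where 'a = complex]
      has_vector_derivative_of_real[OF d21, where 'a = complex] has_vector_derivative_of_real[OF DERIV_minus[OF d11], where 'a = complex]
    by (simp add: algebra_simps)
  thus ?thesis by (intro has_vector_derivative_vecI) simp_all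
qed

section \<open>From the system to the spheroidal equation\<close>

text \<open>The algebraic part of the passage to the spheroidal equation. With \<open>y1\<close> and \<open>y2\<close> subject to
  \<open>y1' = k y2 - p y1\<close> and \<open>y2' = p y2 - 2 y1\<close>, the left-hand side is \<open>h' - P' h / (2 P)\<close> for
  \<open>h = (m (1 - 2 Z) - 4 b P) y2 - 4 P y1\<close>, that is, the derivative of \<open>h / \<surd>P\<close> multiplied by \<open>\<surd>P\<close>.\<close>
lemma spheroidal_identity:
  fixes Z m b g p k y1 y2 :: complex
  assumes Z: "Z \<noteq> 0" "Z \<noteq> 1"
  defines "P \<equiv> Z * (1 - Z)"
  defines "p \<equiv> (m + 1) / 2 * (1 / Z) - (m + 1) / 2 * (1 / (1 - Z)) - 2 * b"
    and "k \<equiv> - 2 * (m + 1) * b / Z + 2 * (g + b\<^sup>2)"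
  shows "(- 2 * m - 4 * b * (1 - 2 * Z)) * y2 + (m * (1 - 2 * Z) - 4 * b * P) * (p * y2 - 2 * y1)
     - (4 * (1 - 2 * Z) * y1 + 4 * P * (k * y2 - p * y1))
     - (1 - 2 * Z) / (2 * P) * ((m * (1 - 2 * Z) - 4 * b * P) * y2 - 4 * P * y1)
     = - 2 * (((m + 1) * (m - 2 * b) + g * (4 * P) - m\<^sup>2 / (4 * P)) * y2)"
proof -
  define i0 i1 where "i0 = 1 / Z" and "i1 = 1 / (1 - Z)"
  have i: "Z * i0 = 1" "(1 - Z) * i1 = 1" using Z by (simp_all add: i0_def i1_def)
  define h where "h = (1 / 2 :: complex)"
  have h: "2 * h = 1" by (simp add: h_def)
  have p: "p = (m + 1) * h * i0 - (m + 1) * h * i1 - 2 * b" by (simp add: p_def i0_def i1_def h_def)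
  have k: "k = - 2 * (m + 1) * b * i0 + 2 * (g + b\<^sup>2)" by (simp add: k_def i0_def)
  have q: "(1 - 2 * Z) / (2 * P) = (1 - 2 * Z) * h * i0 * i1" "m\<^sup>2 / (4 * P) = m\<^sup>2 * h * h * i0 * i1"
    by (simp_all add: P_def i0_def i1_def h_def)
  show ?thesis unfolding q p k unfolding P_def using i h by algebra
qed

text \<open>The eigenfunction is \<open>w = y2 / \<surd>P\<close> with \<open>P = z (1 - z)\<close> and \<open>z = (1 + x) / 2\<close>. In these terms
  \<open>(1 - x\<^sup>2) w'\<close> is \<open>h / \<surd>P\<close>, where \<open>h\<close> has only polynomial coefficients in \<open>y1\<close> and \<open>y2\<close>, so the
  spheroidal equation is a statement about the derivative of \<open>h / \<surd>P\<close>. If \<open>w\<close> vanished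
  identically, so would \<open>y2\<close>, and then \<open>y1\<close> by the equation for \<open>y2'\<close>.\<close>
lemma spheroidal_eigenvalue_of_solution:
  fixes \<mu> g b C :: real
  assumes mu: "\<mu> \<ge> 0" and sol: "solves (system_matrix \<mu> 0 g b (- 2 * (\<mu> + 1) * b)) \<eta>"
    and decay: "\<And>z. z \<in> {0<..<1} \<Longrightarrow> norm (\<eta> z) \<le> C * (z * (1 - z)) powr alpha \<mu>"
    and nz: "\<And>z. z \<in> {0<..<1} \<Longrightarrow> \<eta> z \<noteq> 0"
  shows "spheroidal_eigenvalue \<mu> g (of_real ((\<mu> + 1) * (\<mu> - 2 * b)))"
proof -
  define p where "p z = alpha \<mu> * (1 / z) - alpha \<mu> * (1 / (1 - z)) - 2 * b" for z
  define k where "k z = - 2 * (\<mu> + 1) * b / z + 2 * (g + b\<^sup>2)" for z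
  define P where "P z = z * (1 - z)" for z :: real
  define r where "r z = 1 / sqrt (P z)" for z
  define y1 y2 where "y1 z = \<eta> z $ 1" and "y2 z = \<eta> z $ 2" for z
  define h where "h z = of_real (\<mu> * (1 - 2 * z) - 4 * b * P z) * y2 z - of_real (4 * P z) * y1 z" for z
  have dy1: "(y1 has_vector_derivative of_real (k z) * y2 z - of_real (p z) * y1 z) (at z)"
    and dy2: "(y2 has_vector_derivative of_real (p z) * y2 z - 2 * y1 z) (at z)" if "z \<in> {0<..<1}" for z
  proof -
    define M where "M = system_matrix \<mu> 0 g b (- 2 * (\<mu> + 1) * b) z"
    have M: "M $ 1 $ 1 = - of_real (p z)" "M $ 1 $ 2 = of_real (k z)" "M $ 2 $ 1 = - 2" "M $ 2 $ 2 = of_real (p z)"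
      by (simp_all add: M_def system_matrix_def p_def k_def scaleR_conv_of_real[where 'a = complex])
    have d: "((\<lambda>z. \<eta> z $ i) has_vector_derivative (M *v \<eta> z) $ i) (at z)" for i
      using sol that by (intro has_vector_derivative_vec_nth) (simp add: solves_def M_def)
    show "(y1 has_vector_derivative of_real (k z) * y2 z - of_real (p z) * y1 z) (at z)"
      using d[of 1] unfolding y1_def[abs_def] y2_def by (simp add: M)
    show "(y2 has_vector_derivative of_real (p z) * y2 z - 2 * y1 z) (at z)"
      using d[of 2] unfolding y2_def[abs_def] y1_def by (simp add: M)
  qed
  have dP: "(P has_real_derivative 1 - 2 * z) (at z)" for z
    unfolding P_def[abs_def]
    by (rule DERIV_cong[OF DERIV_mult[OF DERIV_ident DERIV_diff[OF DERIV_const DERIV_ident]]]) simp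
  have dr: "(r has_real_derivative - (1 - 2 * z) / (2 * P z) * r z) (at z)" if "z \<in> {0<..<1}" for z
  proof -
    have pos: "P z > 0" using that by (simp add: P_def)
    have "((\<lambda>z. sqrt (P z)) has_real_derivative inverse (sqrt (P z)) / 2 * (1 - 2 * z)) (at z)"
      by (rule DERIV_chain2[OF DERIV_real_sqrt[OF pos] dP])
    from DERIV_divide[OF DERIV_const[of 1] this]
    have "(r has_real_derivative - ((1 - 2 * z) * (inverse (sqrt (P z)) / 2)) / (sqrt (P z) * sqrt (P z))) (at z)"
      unfolding r_def[abs_def] using pos by (simp add: mult.commute)
    also have "- ((1 - 2 * z) * (inverse (sqrt (P z)) / 2)) / (sqrt (P z) * sqrt (P z)) = - (1 - 2 * z) / (2 * P z) * r z"
      using pos by (simp add: r_def field_simps)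
    finally show ?thesis .
  qed
  have dcr: "((\<lambda>z. complex_of_real (r z)) has_vector_derivative of_real (- (1 - 2 * z) / (2 * P z) * r z)) (at z)"
    if "z \<in> {0<..<1}" for z
    by (rule has_vector_derivative_of_real[OF dr[OF that]])
  define W where "W z = of_real (r z) * y2 z" for z
  have dW: "(W has_vector_derivative of_real (r z) * h z / of_real (2 * P z)) (at z)" if z: "z \<in> {0<..<1}" for z
  proof -
    have "(W has_vector_derivative of_real (r z) * (of_real (p z) * y2 z - 2 * y1 z)
        + of_real (- (1 - 2 * z) / (2 * P z) * r z) * y2 z) (at z)"
      unfolding W_def[abs_def] by (rule has_vector_derivative_mult[OF dcr[OF z] dy2[OF z]])
    also have "of_real (r z) * (of_real (p z) * y2 z - 2 * y1 z) + of_real (- (1 - 2 * z) / (2 * P z) * r z) * y2 z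
      = of_real (r z) * h z / of_real (2 * P z)"
    proof -
      have "p z - (1 - 2 * z) / (2 * P z) = (\<mu> * (1 - 2 * z) - 4 * b * P z) / (2 * P z)"
      proof -
        have nz: "2 * P z \<noteq> 0" using z by (simp add: P_def)
        have inv: "z * (1 / z) = 1" "(1 - z) * (1 / (1 - z)) = 1" "2 * alpha \<mu> = \<mu> + 1"
          using z by (simp_all add: alpha_def)
        have "p z * (2 * P z) = (\<mu> + 1) * (1 - 2 * z) - 4 * b * P z"
          unfolding p_def P_def using inv by algebra
        hence "p z = ((\<mu> + 1) * (1 - 2 * z) - 4 * b * P z) / (2 * P z)"
          using nz by (simp only: nonzero_eq_divide_eq simp_thms)
        thus ?thesis by (simp only: diff_divide_distrib[symmetric]) (simp add: algebra_simps)
      qed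
      hence "of_real (p z) - of_real ((1 - 2 * z) / (2 * P z)) = (of_real (\<mu> * (1 - 2 * z) - 4 * b * P z) / of_real (2 * P z) :: complex)"
        by (metis of_real_diff of_real_divide)
      moreover have "of_real (4 * P z) * y1 z / of_real (2 * P z) = 2 * y1 z"
      proof -
        have "P z \<noteq> 0" using z by (simp add: P_def)
        thus ?thesis by simp
      qed
      ultimately have quot: "h z / of_real (2 * P z) = of_real (p z) * y2 z - of_real ((1 - 2 * z) / (2 * P z)) * y2 z - 2 * y1 z"
        unfolding h_def diff_divide_distrib by (metis left_diff_distrib times_divide_eq_left)
      have sgn: "complex_of_real (- (1 - 2 * z) / (2 * P z) * r z) = - of_real ((1 - 2 * z) / (2 * P z)) * of_real (r z)"
        by (simp only: minus_divide_left[symmetric] of_real_minus of_real_mult)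
      show ?thesis
        unfolding sgn times_divide_eq_right[symmetric] quot by algebra
    qed
    finally show ?thesis .
  qed
  have dh: "((\<lambda>z. of_real (r z) * h z) has_vector_derivative
      - 2 * ((of_real ((\<mu> + 1) * (\<mu> - 2 * b)) + of_real (g * (4 * P z)) - of_real (\<mu>\<^sup>2 / (4 * P z))) * W z)) (at z)"
    if z: "z \<in> {0<..<1}" for z
  proof -
    have c1: "((\<lambda>z. complex_of_real (\<mu> * (1 - 2 * z) - 4 * b * P z)) has_vector_derivative
        of_real (- 2 * \<mu> - 4 * b * (1 - 2 * z))) (at z)"
      by (rule has_vector_derivative_of_real, rule DERIV_cong,
          (rule dP DERIV_const DERIV_ident DERIV_diff DERIV_cmult)+) simp
    have c2: "((\<lambda>z. complex_of_real (4 * P z)) has_vector_derivative of_real (4 * (1 - 2 * z))) (at z)"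
      by (intro has_vector_derivative_of_real DERIV_cmult dP)
    have "(h has_vector_derivative
        (of_real (\<mu> * (1 - 2 * z) - 4 * b * P z) * (of_real (p z) * y2 z - 2 * y1 z) + of_real (- 2 * \<mu> - 4 * b * (1 - 2 * z)) * y2 z)
       - (of_real (4 * P z) * (of_real (k z) * y2 z - of_real (p z) * y1 z) + of_real (4 * (1 - 2 * z)) * y1 z)) (at z)"
      unfolding h_def[abs_def]
      by (intro has_vector_derivative_diff has_vector_derivative_mult c1 c2 dy1 dy2 z)
    from has_vector_derivative_mult[OF dcr[OF z] this] show ?thesis
    proof (rule has_vector_derivative_eq_rhs)
      have Z: "complex_of_real z \<noteq> 0" "complex_of_real z \<noteq> 1" using z by auto
      define K Q where "K = (1 - 2 * z) / (2 * P z)" and "Q = \<mu>\<^sup>2 / (4 * P z)"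
      have of_real_quot: "complex_of_real (p z) = (of_real \<mu> + 1) / 2 * (1 / of_real z) - (of_real \<mu> + 1) / 2 * (1 / (1 - of_real z)) - 2 * of_real b"
        "complex_of_real (k z) = - 2 * (of_real \<mu> + 1) * of_real b / of_real z + 2 * (of_real g + (of_real b)\<^sup>2)"
        "complex_of_real (P z) = of_real z * (1 - of_real z)"
        "complex_of_real K = (1 - 2 * of_real z) / (2 * (of_real z * (1 - of_real z)))"
        "complex_of_real Q = (of_real \<mu>)\<^sup>2 / (4 * (of_real z * (1 - of_real z)))"
        by (simp_all add: p_def k_def P_def K_def Q_def alpha_def)
      note id = spheroidal_identity[OF Z, of "of_real \<mu>" "of_real b" "y2 z" "y1 z" "of_real g", folded of_real_quot]
      have "of_real (r z) *
         ((of_real (\<mu> * (1 - 2 * z) - 4 * b * P z) * (of_real (p z) * y2 z - 2 * y1 z) + of_real (- 2 * \<mu> - 4 * b * (1 - 2 * z)) * y2 z)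
         - (of_real (4 * P z) * (of_real (k z) * y2 z - of_real (p z) * y1 z) + of_real (4 * (1 - 2 * z)) * y1 z))
         + of_real (- K * r z) * h z
         = - 2 * ((of_real ((\<mu> + 1) * (\<mu> - 2 * b)) + of_real (g * (4 * P z)) - of_real Q) * W z)"
        unfolding h_def W_def of_real_add of_real_diff of_real_mult of_real_minus of_real_1 of_real_numeral
        using id by algebra
      thus "of_real (r z) *
         ((of_real (\<mu> * (1 - 2 * z) - 4 * b * P z) * (of_real (p z) * y2 z - 2 * y1 z) + of_real (- 2 * \<mu> - 4 * b * (1 - 2 * z)) * y2 z)
         - (of_real (4 * P z) * (of_real (k z) * y2 z - of_real (p z) * y1 z) + of_real (4 * (1 - 2 * z)) * y1 z))
         + of_real (- (1 - 2 * z) / (2 * P z) * r z) * h z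
         = - 2 * ((of_real ((\<mu> + 1) * (\<mu> - 2 * b)) + of_real (g * (4 * P z)) - of_real (\<mu>\<^sup>2 / (4 * P z))) * W z)"
        unfolding K_def Q_def minus_divide_left .
    qed
  qed
  define Z where "Z x = (1 + x) / 2" for x :: real
  have ZI: "Z x \<in> {0<..<1}" if "x \<in> {-1<..<1}" for x using that by (auto simp: Z_def)
  have PZ: "4 * P (Z x) = 1 - x\<^sup>2" for x by (simp add: P_def Z_def power2_eq_square field_simps)
  have dZ: "(Z has_vector_derivative (1 / 2)) (at x)" for x
    unfolding Z_def[abs_def] has_real_derivative_iff_has_vector_derivative[symmetric] by (auto intro!: derivative_eq_intros)
  define w where "w x = W (Z x)" for x
  define w' where "w' x = (1 / 2) *\<^sub>R (of_real (r (Z x)) * h (Z x) / of_real (2 * P (Z x)))" for x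
  have "spheroidal_solution \<mu> g (of_real ((\<mu> + 1) * (\<mu> - 2 * b))) w"
    unfolding spheroidal_solution_def
  proof (intro exI[of _ w'] ballI conjI)
    fix x :: real assume x: "x \<in> {-1<..<1}"
    show "(w has_vector_derivative w' x) (at x)"
      using vector_diff_chain_at[OF dZ[of x] dW[OF ZI[OF x]]] by (simp add: w_def[abs_def] w'_def o_def)
    have eq: "of_real (r (Z x)) * h (Z x) = of_real (1 - x\<^sup>2) * w' x" if "x \<in> {-1<..<1}" for x
    proof -
      have "P (Z x) \<noteq> 0" using ZI[OF that] by (simp add: P_def)
      thus ?thesis unfolding w'_def PZ[symmetric] by (simp add: scaleR_conv_of_real)
    qed
    have "((\<lambda>x. of_real (r (Z x)) * h (Z x)) has_vector_derivative
       - ((of_real ((\<mu> + 1) * (\<mu> - 2 * b)) + of_real (g * (1 - x\<^sup>2)) - of_real (\<mu>\<^sup>2 / (1 - x\<^sup>2))) * w x)) (at x)"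
      using vector_diff_chain_at[OF dZ[of x] dh[OF ZI[OF x]]]
      unfolding PZ by (simp add: o_def w_def scaleR_conv_of_real)
    thus "((\<lambda>x. of_real (1 - x\<^sup>2) * w' x) has_vector_derivative
       - ((of_real ((\<mu> + 1) * (\<mu> - 2 * b)) + of_real (g * (1 - x\<^sup>2)) - of_real (\<mu>\<^sup>2 / (1 - x\<^sup>2))) * w x)) (at x)"
      by (rule has_vector_derivative_transform_within_open[of _ _ _ "{-1<..<1}"]) (use x eq in auto)
  qed
  moreover have "bounded (w ` {-1<..<1})"
  proof (rule boundedI, clarify)
    fix x :: real assume "x \<in> {-1<..<1}"
    hence z: "Z x \<in> {0<..<1}" by (rule ZI)
    define c where "c = P (Z x)"
    have c: "0 < c" using z by (simp add: c_def P_def)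
    have c1: "c \<le> 1" using z mult_mono[of "Z x" 1 "1 - Z x" 1] by (simp add: c_def P_def)
    have "0 \<le> C * c powr alpha \<mu>" using order_trans[OF norm_ge_zero decay[OF z]] by (simp add: c_def P_def)
    hence C: "C \<ge> 0" using c by (simp add: zero_le_mult_iff)
    have "norm (w x) = r (Z x) * norm (y2 (Z x))"
    proof -
      have "r (Z x) \<ge> 0" using c by (simp add: r_def c_def)
      thus ?thesis by (simp add: w_def W_def norm_mult)
    qed
    also have "\<dots> \<le> r (Z x) * (C * c powr alpha \<mu>)"
      using order_trans[OF Finite_Cartesian_Product.norm_nth_le decay[OF z]] c
      by (intro mult_left_mono) (auto simp: y2_def c_def P_def r_def)
    also have "\<dots> = C * (c powr alpha \<mu> / c powr (1 / 2))" using c by (simp add: r_def c_def powr_half_sqrt)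
    also have "\<dots> = C * c powr (\<mu> / 2)" by (simp add: alpha_def powr_diff[symmetric] add_divide_distrib)
    also have "\<dots> \<le> C * 1" using C c c1 mu by (intro mult_left_mono powr_le1) auto
    finally show "norm (w x) \<le> C" by simp
  qed
  moreover have "\<exists>x\<in>{-1<..<1}. w x \<noteq> 0"
  proof (rule ccontr)
    assume "\<not> ?thesis"
    hence w0: "w x = 0" if "x \<in> {-1<..<1}" for x using that by blast
    have y20: "y2 z = 0" if "z \<in> {0<..<1}" for z
    proof -
      have "w (2 * z - 1) = 0" using that by (intro w0) auto
      moreover have "r z \<noteq> 0" using that by (simp add: r_def P_def)
      ultimately show ?thesis by (simp add: w_def W_def Z_def)
    qed
    have half: "(1/2 :: real) \<in> {0<..<1}" by simp
    have "((\<lambda>_. 0) has_vector_derivative of_real (p (1/2)) * y2 (1/2) - 2 * y1 (1/2)) (at (1/2))"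
      by (rule has_vector_derivative_transform_within_open[OF dy2[OF half], of "{0<..<1}"]) (use half y20 in auto)
    moreover have "((\<lambda>_. 0 :: complex) has_vector_derivative 0) (at (1/2::real))" by (rule has_vector_derivative_const)
    ultimately have "of_real (p (1/2)) * y2 (1/2) - 2 * y1 (1/2) = 0" by (rule vector_derivative_unique_at)
    hence "y1 (1/2) = 0" using y20[OF half] by simp
    hence "\<eta> (1/2) = 0" using y20[OF half] by (simp add: vec_eq_iff forall_2 y1_def y2_def)
    thus False using nz[OF half] by simp
  qed
  ultimately show ?thesis unfolding spheroidal_eigenvalue_def by blast
qed

section \<open>Eigenvalues along the deformation\<close>

theorem theorem4:
  fixes \<mu> a b \<Lambda>0 t0 :: real
    and u1 u2 \<Lambda> :: "real \<Rightarrow> real"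
    and I :: "real set"
  assumes "\<mu> \<ge> 0"
    and "is_interval I" and "0 \<in> I"
    and "\<And>t. t \<in> I \<Longrightarrow> (u1 has_real_derivative 2 * u1 t) (at t within I)"
    and "\<And>t. t \<in> I \<Longrightarrow>
           (u2 has_real_derivative
              2 * (\<Lambda> t + 1) * (u1 t + (u2 t)^2) - (2 * \<mu> + 1) * u2 t) (at t within I)"
    and "\<And>t. t \<in> I \<Longrightarrow>
           (\<Lambda> has_real_derivative
              (1 + 2 * \<mu> - 2 * \<Lambda> t * u2 t) * (\<Lambda> t + 2) - 2 * \<mu>) (at t within I)"
    and "u1 0 = a" and "u2 0 = b" and "\<Lambda> 0 = \<Lambda>0"
    and "Theta \<mu> (of_real \<Lambda>0) a b ((a + b^2 - 1) * \<Lambda>0 - 2 * (\<mu> + 1) * b) = 0"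
    and "t0 \<in> I" and "\<Lambda> t0 = 0"
  shows "spheroidal_eigenvalue \<mu> (u1 t0) (of_real ((\<mu> + 1) * (\<mu> - 2 * u2 t0)))"
proof -
  \<comment> \<open>Time is rescaled to \<open>t = s t\<^sub>0\<close> with \<open>0 \<le> s \<le> 1\<close>, which also covers negative \<open>t\<^sub>0\<close>.\<close>
  have path: "s * t0 \<in> I" if "s \<in> {0..1}" for s
  proof (cases "t0 \<ge> 0")
    case True
    hence "0 \<le> s * t0" "s * t0 \<le> t0" using that mult_right_mono[of s 1 t0] by auto
    thus ?thesis by (rule mem_is_interval_1_I[OF assms(2,3,11)])
  next
    case False
    hence "t0 \<le> s * t0" "s * t0 \<le> 0" using that mult_right_mono_neg[of s 1 t0] by (auto simp: mult_nonneg_nonpos)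
    thus ?thesis by (rule mem_is_interval_1_I[OF assms(2,11,3)])
  qed
  define U1 U2 L where "U1 s = u1 (s * t0)" and "U2 s = u2 (s * t0)" and "L s = \<Lambda> (s * t0)" for s
  have chain: "((\<lambda>s. f (s * t0)) has_real_derivative t0 * D) (at s within {0..1})"
    if "(f has_real_derivative D) (at (s * t0) within I)" for f D s
  proof -
    have "(f has_real_derivative D) (at (s * t0) within (\<lambda>s. s * t0) ` {0..1})"
      by (rule has_field_derivative_subset[OF that]) (use path in auto)
    moreover have "((\<lambda>s. s * t0) has_real_derivative t0) (at s within {0..1})"
      by (auto intro!: derivative_eq_intros)
    ultimately have "(f \<circ> (\<lambda>s. s * t0) has_real_derivative D * t0) (at s within {0..1})"
      by (rule DERIV_image_chain)
    thus ?thesis by (simp add: o_def mult.commute)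
  qed
  have dU1: "(U1 has_real_derivative t0 * (2 * U1 s)) (at s within {0..1})"
    and dU2: "(U2 has_real_derivative t0 * (2 * (L s + 1) * (U1 s + (U2 s)\<^sup>2) - (2 * \<mu> + 1) * U2 s)) (at s within {0..1})"
    and dL: "(L has_real_derivative t0 * ((1 + 2 * \<mu> - 2 * L s * U2 s) * (L s + 2) - 2 * \<mu>)) (at s within {0..1})"
    if "s \<in> {0..1}" for s
    unfolding U1_def U2_def L_def by (intro chain assms path that)+
  have cont: "continuous_on {0..1} U1" "continuous_on {0..1} U2" "continuous_on {0..1} L"
    by (rule DERIV_continuous_on, rule dU1 dU2 dL, assumption)+
  define M where "M s = system_matrix \<mu> (of_real (L s)) (U1 s) (U2 s)
      ((U1 s + (U2 s)\<^sup>2 - 1) * L s - 2 * (\<mu> + 1) * U2 s)" for s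
  have "Theta \<mu> (of_real (L 0)) (U1 0) (U2 0) ((U1 0 + (U2 0)\<^sup>2 - 1) * L 0 - 2 * (\<mu> + 1) * U2 0) = 0"
    using assms(7-10) by (simp add: L_def U1_def U2_def)
  then obtain \<eta> C where \<eta>: "solves (M 0) \<eta>" "\<And>z. z \<in> {0<..<1} \<Longrightarrow> \<eta> z \<noteq> 0"
    "\<And>z. z \<in> {0<..<1} \<Longrightarrow> norm (\<eta> z) \<le> C * (z * (1 - z)) powr alpha \<mu>"
    unfolding M_def using Theta_zero_imp_decaying_solution[OF assms(1)] by metis
  obtain \<zeta> E where \<zeta>: "solves (M 1) \<zeta>" "E \<ge> 0"
    "\<And>z. z \<in> {0<..<1} \<Longrightarrow> norm (\<zeta> z) \<le> E * norm (\<eta> z)"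
    "\<And>z. z \<in> {0<..<1} \<Longrightarrow> norm (\<eta> z) \<le> E * norm (\<zeta> z)"
  proof (rule isomonodromic_transport[of "\<lambda>s. t0 *\<^sub>R deformation_constant \<mu> (L s) (U1 s) (U2 s)"
        "\<lambda>s. t0 *\<^sub>R infinity_matrix (U1 s) (U2 s)" M \<eta>])
    show "continuous_on {0..1} (\<lambda>s. t0 *\<^sub>R deformation_constant \<mu> (L s) (U1 s) (U2 s))"
      "continuous_on {0..1} (\<lambda>s. t0 *\<^sub>R infinity_matrix (U1 s) (U2 s))"
      unfolding deformation_constant_def infinity_matrix_def
      by (intro continuous_on_scaleR continuous_on_const continuous_on_mat22 continuous_intros cont)+
    show "((\<lambda>s. M s z) has_vector_derivative
         t0 *\<^sub>R infinity_matrix (U1 s) (U2 s) +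
         (t0 *\<^sub>R deformation_constant \<mu> (L s) (U1 s) (U2 s) + z *\<^sub>R t0 *\<^sub>R infinity_matrix (U1 s) (U2 s)) ** M s z -
         M s z ** (t0 *\<^sub>R deformation_constant \<mu> (L s) (U1 s) (U2 s) + z *\<^sub>R t0 *\<^sub>R infinity_matrix (U1 s) (U2 s)))
         (at s within {0..1})"
      if "s \<in> {0..1}" "z \<in> {0<..<1}" for s z
      unfolding M_def by (rule zero_curvature[OF dU1 dU2 dL]) (use that in auto)
  qed (use \<eta> in blast)+
  have M1: "M 1 = system_matrix \<mu> 0 (u1 t0) (u2 t0) (- 2 * (\<mu> + 1) * u2 t0)"
    by (simp add: M_def L_def U1_def U2_def assms(12) algebra_simps)
  show ?thesis
  proof (rule spheroidal_eigenvalue_of_solution[OF assms(1) \<zeta>(1)[unfolded M1]])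
    fix z :: real assume z: "z \<in> {0<..<1}"
    have "norm (\<zeta> z) \<le> E * norm (\<eta> z)" by (rule \<zeta>(3)[OF z])
    also have "\<dots> \<le> E * (C * (z * (1 - z)) powr alpha \<mu>)" by (intro mult_left_mono \<eta> z \<zeta>(2))
    finally show "norm (\<zeta> z) \<le> (E * C) * (z * (1 - z)) powr alpha \<mu>" by simp
    show "\<zeta> z \<noteq> 0" using \<eta>(2)[OF z] \<zeta>(4)[OF z] by auto
  qed
qed

end
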